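(* Let $q\in\mathbb{C}^*$ and $k\ge 2$, and assume that $H_2(0,1;q)$ is semisimple. Let $I$ be the two-sided ideal of $H_k(0,1;q)$ generated by the minimal ideal $I^{((1^2),\emptyset)}$ of $H_2(0,1;q)$ corresponding to the pair of partitions $((1^2),\emptyset)$. Then $$R_k(q)\cong H_k(0,1;q)/I ,$$ where the images of the generators $X_1,T_1,\dots,T_{k-1}$ of $H_k(0,1;q)$ correspond to $1-P_1,T_1,\dots,T_{k-1}\in R_k(q)$.
   Context: All algebras are associative unital $\mathbb{C}$-algebras; ideals are two-sided. The $q$-rook monoid algebra $R_k(q)$ is the algebra given by generators $P_1,\dots,P_k$ and $T_1,\dots,T_{k-1}$ with relations (A1) $T_i^2=(q-q^{-1})T_i+1$ for $1\le i\le k-1$; (A2) $T_iT_{i+1}T_i=T_{i+1}T_iT_{i+1}$ for $1\le i\le k-2$; (A3) $T_iT_j=T_jT_i$ for $|i-j|>1$; (R1) $P_i^2=P_i$ for $1\le i\le k$; (R2) $P_iP_j=P_jP_i$ for $1\le i,j\le k$; (R3) $P_iT_j=T_jP_i$ for $1\le i<j\le k-1$; (R4) $P_iT_j=T_jP_i=qP_i$ for $1\le j<i\le k$; (R5) $P_{i+1}=qP_iT_i^{-1}P_i=q\bigl(P_iT_iP_i-(q-q^{-1})P_i\bigr)$ for $1\le i\le k-1$. For $u_1,u_2\in\mathbb{C}$, the Iwahori-Hecke algebra $H_k(u_1,u_2;q)$ of type $B_k$ is given by generators $X_1,T_1,\dots,T_{k-1}$ with relations (A1), (A2), (A3), $X_1T_j=T_jX_1$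 for $2\le j\le k-1$, $X_1T_1X_1T_1=T_1X_1T_1X_1$, and $(X_1-u_1)(X_1-u_2)=0$. The algebra $H_2(u_1,u_2;q)$ is regarded as the subalgebra of $H_k(u_1,u_2;q)$ generated by $X_1,T_1$. When $H_2(u_1,u_2;q)$ is semisimple, its minimal ideals are its simple Wedderburn components, and the minimal ideal $I^{((1^2),\emptyset)}$ is the component corresponding to the one-dimensional representation $X_1\mapsto u_1$, $T_1\mapsto -q^{-1}$ (the irreducible representation indexed by $((1^2),\emptyset)$), i.e. the minimal ideal which acts nontrivially on that representation and annihilates all other irreducible representations. *)

theory Defs
  imports
    "HOL-Library.Poly_Mapping"
    "HOL-Algebra.QuotRing"
    "HOL-Algebra.Module"
    "Jordan_Normal_Form.Matrix"
begin

section \<open>Free algebras, quotients and presentations\<close>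

text \<open>
  A complex algebra is a record of type \<^typ>\<open>(complex, 'a) module\<close> (a ring together with a
  scalar multiplication).  The locale named algebra of the library demands commutativity and is
  not used.  An element of the free algebra is a finitely supported function from words to
  complex numbers; with concatenation as addition of words, the product of
  \<^type>\<open>poly_mapping\<close> is the product of the free algebra.
\<close>

instantiation list :: (type) monoid_add
begin

definition zero_list_def: "0 = []"

definition plus_list_def: "xs + ys = xs @ ys"

instance
  by standard (simp_all add: zero_list_def plus_list_def)

end

type_synonym 'g free = "('g list, complex) poly_mapping"

definition gen :: "'g \<Rightarrow> 'g free" where
  "gen g = Poly_Mapping.single [g] 1"

definition scal :: "complex \<Rightarrow> 'g free" where
  "scal c = Poly_Mapping.single [] c"

definition free_alg :: "'g set \<Rightarrow> (complex, 'g free) module" where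
  "free_alg G = \<lparr>
     carrier = {p. \<forall>w \<in> Poly_Mapping.keys p. set w \<subseteq> G},
     monoid.mult = (*), one = 1, zero = 0, add = (+),
     smult = (\<lambda>c p. scal c * p)\<rparr>"

lemma ring_free_alg: "ring (free_alg G)"
proof -
  let ?C = "{p :: 'a free. \<forall>w \<in> Poly_Mapping.keys p. set w \<subseteq> G}"
  have add: "p + r \<in> ?C" if "p \<in> ?C" "r \<in> ?C" for p r
    using that Poly_Mapping.keys_add[of p r] by blast
  have mult: "p * r \<in> ?C" if "p \<in> ?C" "r \<in> ?C" for p r
  proof -
    have "Poly_Mapping.keys (p * r) \<subseteq>
        {a + b | a b. a \<in> Poly_Mapping.keys p \<and> b \<in> Poly_Mapping.keys r}"
      by (rule keys_mult)
    then show ?thesis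
      using that unfolding plus_list_def by fastforce
  qed
  have one: "1 \<in> ?C"
    by (simp add: zero_list_def)
  have "abelian_group (free_alg G)"
  proof (rule abelian_groupI)
    fix x assume "x \<in> carrier (free_alg G)"
    then show "\<exists>y \<in> carrier (free_alg G). y \<oplus>\<^bsub>free_alg G\<^esub> x = \<zero>\<^bsub>free_alg G\<^esub>"
      by (intro bexI[of _ "- x"]) (simp_all add: free_alg_def)
  next
    fix x y assume "x \<in> carrier (free_alg G)" "y \<in> carrier (free_alg G)"
    then show "x \<oplus>\<^bsub>free_alg G\<^esub> y \<in> carrier (free_alg G)"
      using add[of x y] by (simp add: free_alg_def)
  qed (simp_all add: free_alg_def add.assoc add.commute)
  moreover have "monoid (free_alg G)"
  proof (rule monoidI)
    fix x y assume "x \<in> carrier (free_alg G)" "y \<in> carrier (free_alg G)"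
    then show "x \<otimes>\<^bsub>free_alg G\<^esub> y \<in> carrier (free_alg G)"
      using mult[of x y] by (simp add: free_alg_def)
  qed (use one in \<open>simp_all add: free_alg_def mult.assoc\<close>)
  ultimately show ?thesis
    by (rule ringI) (simp_all add: free_alg_def ring_distribs)
qed

lemma free_alg_mono: "G \<subseteq> H \<Longrightarrow> carrier (free_alg G) \<subseteq> carrier (free_alg H)"
  unfolding free_alg_def by fastforce

lemma free_alg_closed:
  "p \<in> carrier (free_alg G) \<Longrightarrow> r \<in> carrier (free_alg G) \<Longrightarrow> p + r \<in> carrier (free_alg G)"
  "p \<in> carrier (free_alg G) \<Longrightarrow> r \<in> carrier (free_alg G) \<Longrightarrow> p * r \<in> carrier (free_alg G)"
  "p \<in> carrier (free_alg G) \<Longrightarrow> r \<in> carrier (free_alg G) \<Longrightarrow> p - r \<in> carrier (free_alg G)"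
  "1 \<in> carrier (free_alg G)"  "0 \<in> carrier (free_alg G)"
  "scal c \<in> carrier (free_alg G)"
  "g \<in> G \<Longrightarrow> gen g \<in> carrier (free_alg G)"
proof -
  interpret ring "free_alg G" by (rule ring_free_alg)
  assume p: "p \<in> carrier (free_alg G)" and r: "r \<in> carrier (free_alg G)"
  show "p + r \<in> carrier (free_alg G)" using add.m_closed[OF p r] by (simp add: free_alg_def)
  show "p * r \<in> carrier (free_alg G)" using m_closed[OF p r] by (simp add: free_alg_def)
  have "- r \<in> carrier (free_alg G)" using r by (simp add: free_alg_def)
  from add.m_closed[OF p this] show "p - r \<in> carrier (free_alg G)" by (simp add: free_alg_def)
next
  interpret ring "free_alg G" by (rule ring_free_alg)
  show "1 \<in> carrier (free_alg G)" using one_closed by (simp add: free_alg_def)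
  show "0 \<in> carrier (free_alg G)" using zero_closed by (simp add: free_alg_def)
qed (auto simp: free_alg_def scal_def gen_def)

definition alg_quot :: "(complex, 'a) module \<Rightarrow> 'a set \<Rightarrow> (complex, 'a set) module" where
  "alg_quot A I =
     ring.extend (A Quot I) (module.fields (\<lambda>c C. \<Union>x\<in>C. I +>\<^bsub>A\<^esub> (c \<odot>\<^bsub>A\<^esub> x)))"

definition rel_ideal :: "'g set \<Rightarrow> ('g free \<times> 'g free) set \<Rightarrow> 'g free set" where
  "rel_ideal G Rel = Idl\<^bsub>free_alg G\<^esub> {l - r | l r. (l, r) \<in> Rel}"

definition presented_alg ::
    "'g set \<Rightarrow> ('g free \<times> 'g free) set \<Rightarrow> (complex, 'g free set) module" where
  "presented_alg G Rel = alg_quot (free_alg G) (rel_ideal G Rel)"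

definition presented_class ::
    "'g set \<Rightarrow> ('g free \<times> 'g free) set \<Rightarrow> 'g free \<Rightarrow> 'g free set" where
  "presented_class G Rel x = rel_ideal G Rel +>\<^bsub>free_alg G\<^esub> x"

definition alg_hom :: "(complex, 'a) module \<Rightarrow> (complex, 'b) module \<Rightarrow> ('a \<Rightarrow> 'b) set" where
  "alg_hom A B =
     {h \<in> Ring.ring_hom A B. \<forall>c. \<forall>x \<in> carrier A. h (c \<odot>\<^bsub>A\<^esub> x) = c \<odot>\<^bsub>B\<^esub> h x}"

definition alg_iso :: "(complex, 'a) module \<Rightarrow> (complex, 'b) module \<Rightarrow> ('a \<Rightarrow> 'b) set" where
  "alg_iso A B = {h \<in> alg_hom A B. bij_betw h (carrier A) (carrier B)}"


section \<open>Semisimplicity, minimal ideals and representations\<close>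

definition left_ideal :: "'a set \<Rightarrow> ('a, 'b) ring_scheme \<Rightarrow> bool" where
  "left_ideal L A \<longleftrightarrow>
     additive_subgroup L A \<and> (\<forall>a \<in> carrier A. \<forall>x \<in> L. a \<otimes>\<^bsub>A\<^esub> x \<in> L)"

definition minimal_left_ideal :: "'a set \<Rightarrow> ('a, 'b) ring_scheme \<Rightarrow> bool" where
  "minimal_left_ideal L A \<longleftrightarrow>
     left_ideal L A \<and> L \<noteq> {\<zero>\<^bsub>A\<^esub>} \<and>
     (\<forall>L'. left_ideal L' A \<and> L' \<subseteq> L \<longrightarrow> L' = {\<zero>\<^bsub>A\<^esub>} \<or> L' = L)"

definition minimal_ideal :: "'a set \<Rightarrow> ('a, 'b) ring_scheme \<Rightarrow> bool" where
  "minimal_ideal J A \<longleftrightarrow>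
     ideal J A \<and> J \<noteq> {\<zero>\<^bsub>A\<^esub>} \<and>
     (\<forall>J'. ideal J' A \<and> J' \<subseteq> J \<longrightarrow> J' = {\<zero>\<^bsub>A\<^esub>} \<or> J' = J)"

text \<open>
  The regular left module is an internal direct sum of simple submodules.  For a unital ring such
  a sum is automatically finite.
\<close>

definition semisimple_alg :: "('a, 'b) ring_scheme \<Rightarrow> bool" where
  "semisimple_alg A \<longleftrightarrow>
     (\<exists>S. finite S \<and> (\<forall>L \<in> S. minimal_left_ideal L A) \<and>
        (\<forall>x \<in> carrier A. \<exists>!f. f \<in> (\<Pi>\<^sub>E L\<in>S. L) \<and> x = (\<Oplus>\<^bsub>A\<^esub>L\<in>S. f L)))"

text \<open>
  Representations are homomorphisms to \<^term>\<open>module_mat TYPE(complex) n n\<close>, the algebra of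
  complex n by n matrices.  They are only used for the algebra \<open>H\<^sub>2\<close>, which is
  finite-dimensional, so that each of its irreducible representations is of this form.
\<close>

definition invariant_subspace ::
    "(complex, 'a) module \<Rightarrow> nat \<Rightarrow> ('a \<Rightarrow> complex mat) \<Rightarrow> complex vec set \<Rightarrow> bool" where
  "invariant_subspace A n \<rho> W \<longleftrightarrow>
     W \<subseteq> carrier_vec n \<and> 0\<^sub>v n \<in> W \<and>
     (\<forall>v \<in> W. \<forall>w \<in> W. v + w \<in> W) \<and>
     (\<forall>c. \<forall>v \<in> W. c \<cdot>\<^sub>v v \<in> W) \<and>
     (\<forall>x \<in> carrier A. \<forall>v \<in> W. \<rho> x *\<^sub>v v \<in> W)"

definition irreducible_rep ::
    "(complex, 'a) module \<Rightarrow> nat \<Rightarrow> ('a \<Rightarrow> complex mat) \<Rightarrow> bool" where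
  "irreducible_rep A n \<rho> \<longleftrightarrow>
     n > 0 \<and> \<rho> \<in> alg_hom A (module_mat TYPE(complex) n n) \<and>
     (\<forall>W. invariant_subspace A n \<rho> W \<longrightarrow> W = {0\<^sub>v n} \<or> W = carrier_vec n)"

definition equivalent_reps ::
    "(complex, 'a) module \<Rightarrow> nat \<Rightarrow> ('a \<Rightarrow> complex mat) \<Rightarrow> nat \<Rightarrow> ('a \<Rightarrow> complex mat) \<Rightarrow> bool"
  where
  "equivalent_reps A n \<rho> m \<sigma> \<longleftrightarrow>
     n = m \<and> (\<exists>S \<in> carrier_mat n n. invertible_mat S \<and>
       (\<forall>x \<in> carrier A. S * \<rho> x = \<sigma> x * S))"

definition corresponding_minimal_ideal ::
    "(complex, 'a) module \<Rightarrow> nat \<Rightarrow> ('a \<Rightarrow> complex mat) \<Rightarrow> 'a set \<Rightarrow> bool" where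
  "corresponding_minimal_ideal A n \<rho> J \<longleftrightarrow>
     minimal_ideal J A \<and>
     (\<exists>x \<in> J. \<rho> x \<noteq> 0\<^sub>m n n) \<and>
     (\<forall>m \<sigma>. irreducible_rep A m \<sigma> \<and> \<not> equivalent_reps A n \<rho> m \<sigma> \<longrightarrow>
        (\<forall>x \<in> J. \<sigma> x = 0\<^sub>m m m))"


section \<open>The q-rook monoid algebra\<close>

datatype rook_gen = RP nat | RT nat

abbreviation rP :: "nat \<Rightarrow> rook_gen free" where "rP i \<equiv> gen (RP i)"
abbreviation rT :: "nat \<Rightarrow> rook_gen free" where "rT i \<equiv> gen (RT i)"

definition rook_gens :: "nat \<Rightarrow> rook_gen set" where
  "rook_gens k = RP ` {1..k} \<union> RT ` {1..k - 1}"

text \<open>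
  By the quadratic relation, \<open>rT i - (q - q\<inverse>)\<close> represents the inverse of the generator
  \<open>T\<^sub>i\<close>; this is how the inverse in the penultimate family of relations is written.
\<close>

definition rook_rels :: "nat \<Rightarrow> complex \<Rightarrow> (rook_gen free \<times> rook_gen free) set" where
  "rook_rels k q =
     {(rT i * rT i, scal (q - inverse q) * rT i + 1) | i. 1 \<le> i \<and> i \<le> k - 1}
   \<union> {(rT i * rT (i+1) * rT i, rT (i+1) * rT i * rT (i+1)) | i. 1 \<le> i \<and> i + 1 \<le> k - 1}
   \<union> {(rT i * rT j, rT j * rT i) | i j.
        i \<in> {1..k - 1} \<and> j \<in> {1..k - 1} \<and> (i + 1 < j \<or> j + 1 < i)}
   \<union> {(rP i * rP i, rP i) | i. 1 \<le> i \<and> i \<le> k}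
   \<union> {(rP i * rP j, rP j * rP i) | i j. i \<in> {1..k} \<and> j \<in> {1..k}}
   \<union> {(rP i * rT j, rT j * rP i) | i j. 1 \<le> i \<and> i < j \<and> j \<le> k - 1}
   \<union> {(rP i * rT j, rT j * rP i) | i j. 1 \<le> j \<and> j < i \<and> i \<le> k}
   \<union> {(rT j * rP i, scal q * rP i) | i j. 1 \<le> j \<and> j < i \<and> i \<le> k}
   \<union> {(rP (i+1), scal q * rP i * (rT i - scal (q - inverse q)) * rP i) | i.
        1 \<le> i \<and> i \<le> k - 1}
   \<union> {(rP (i+1), scal q * (rP i * rT i * rP i - scal (q - inverse q) * rP i)) | i.
        1 \<le> i \<and> i \<le> k - 1}"

lemma rook_rels_closed:
  "{l - r | l r. (l, r) \<in> rook_rels k q} \<subseteq> carrier (free_alg (rook_gens k))"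
  unfolding rook_rels_def
  by (auto simp: rook_gens_def intro!: free_alg_closed)

definition rook_alg :: "nat \<Rightarrow> complex \<Rightarrow> (complex, rook_gen free set) module" where
  "rook_alg k q = presented_alg (rook_gens k) (rook_rels k q)"

definition rook_class :: "nat \<Rightarrow> complex \<Rightarrow> rook_gen free \<Rightarrow> rook_gen free set" where
  "rook_class k q = presented_class (rook_gens k) (rook_rels k q)"


section \<open>The Iwahori-Hecke algebra of type B\<close>

datatype hecke_gen = HX | HT nat

abbreviation hX :: "hecke_gen free" where "hX \<equiv> gen HX"
abbreviation hT :: "nat \<Rightarrow> hecke_gen free" where "hT i \<equiv> gen (HT i)"

definition hecke_gens :: "nat \<Rightarrow> hecke_gen set" where
  "hecke_gens k = insert HX (HT ` {1..k - 1})"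

text \<open>For \<open>k = 1\<close> there is no \<open>T\<^sub>1\<close>, whence the side condition of the relation of length 4.\<close>

definition hecke_rels ::
    "nat \<Rightarrow> complex \<Rightarrow> complex \<Rightarrow> complex \<Rightarrow> (hecke_gen free \<times> hecke_gen free) set" where
  "hecke_rels k u1 u2 q =
     {(hT i * hT i, scal (q - inverse q) * hT i + 1) | i. 1 \<le> i \<and> i \<le> k - 1}
   \<union> {(hT i * hT (i+1) * hT i, hT (i+1) * hT i * hT (i+1)) | i. 1 \<le> i \<and> i + 1 \<le> k - 1}
   \<union> {(hT i * hT j, hT j * hT i) | i j.
        i \<in> {1..k - 1} \<and> j \<in> {1..k - 1} \<and> (i + 1 < j \<or> j + 1 < i)}
   \<union> {(hX * hT j, hT j * hX) | j. 2 \<le> j \<and> j \<le> k - 1}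
   \<union> (if k \<ge> 2 then {(hX * hT 1 * hX * hT 1, hT 1 * hX * hT 1 * hX)} else {})
   \<union> {((hX - scal u1) * (hX - scal u2), 0)}"

lemma hecke_rels_closed:
  "{l - r | l r. (l, r) \<in> hecke_rels k u1 u2 q} \<subseteq> carrier (free_alg (hecke_gens k))"
  unfolding hecke_rels_def
  by (auto simp: hecke_gens_def intro!: free_alg_closed)

lemma rel_ideal_hecke_mono:
  assumes "2 \<le> k"
  shows "rel_ideal (hecke_gens 2) (hecke_rels 2 u1 u2 q)
    \<subseteq> rel_ideal (hecke_gens k) (hecke_rels k u1 u2 q)"
proof -
  let ?A = "free_alg (hecke_gens 2)" and ?B = "free_alg (hecke_gens k)"
  let ?I = "rel_ideal (hecke_gens k) (hecke_rels k u1 u2 q)"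
  let ?S = "\<lambda>k. {l - r | l r. (l, r) \<in> hecke_rels k u1 u2 q}"
  interpret A: ring ?A by (rule ring_free_alg)
  interpret B: ring ?B by (rule ring_free_alg)
  have I: "ideal ?I ?B"
    unfolding rel_ideal_def by (rule B.genideal_ideal[OF hecke_rels_closed])
  interpret I: ideal ?I ?B by (rule I)
  have sub: "carrier ?A \<subseteq> carrier ?B"
    using assms by (intro free_alg_mono) (auto simp: hecke_gens_def)
  have rels: "?S 2 \<subseteq> ?S k"
    using assms unfolding hecke_rels_def by fastforce
  have ops: "monoid.mult ?B = monoid.mult ?A" "add ?B = add ?A" "zero ?B = zero ?A"
    by (auto simp: free_alg_def)
  have neg: "- x \<in> ?I" if "x \<in> ?I" for x
  proof -
    have "\<ominus>\<^bsub>?B\<^esub> x \<in> ?I" using that by simp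
    moreover have "\<ominus>\<^bsub>?B\<^esub> x = - x"
      by (rule B.minus_equality) (use that I.a_subset in \<open>auto simp: free_alg_def\<close>)
    ultimately show ?thesis by simp
  qed
  have "ideal (?I \<inter> carrier ?A) ?A"
  proof (rule idealI[OF A.ring_axioms])
    show "subgroup (?I \<inter> carrier ?A) (add_monoid ?A)"
    proof (rule A.add.subgroupI)
      show "?I \<inter> carrier ?A \<noteq> {}"
        using I.zero_closed A.zero_closed ops(3) by auto
      show "\<ominus>\<^bsub>?A\<^esub> x \<in> ?I \<inter> carrier ?A" if "x \<in> ?I \<inter> carrier ?A" for x
      proof -
        have "\<ominus>\<^bsub>?A\<^esub> x = - x"
          by (rule A.minus_equality) (use that in \<open>auto simp: free_alg_def\<close>)
        then show ?thesis
          using neg[of x] that by (auto simp: free_alg_def)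
      qed
      show "x \<oplus>\<^bsub>?A\<^esub> y \<in> ?I \<inter> carrier ?A"
        if "x \<in> ?I \<inter> carrier ?A" "y \<in> ?I \<inter> carrier ?A" for x y
        using I.a_closed[of x y] A.add.m_closed[of x y] that ops(2) by simp
    qed simp_all
  next
    fix a x assume "a \<in> ?I \<inter> carrier ?A" "x \<in> carrier ?A"
    then show "x \<otimes>\<^bsub>?A\<^esub> a \<in> ?I \<inter> carrier ?A" "a \<otimes>\<^bsub>?A\<^esub> x \<in> ?I \<inter> carrier ?A"
      using I.I_l_closed[of a x] I.I_r_closed[of a x] A.m_closed[of a x] A.m_closed[of x a] sub
        ops(1) by auto
  qed
  moreover have "?S 2 \<subseteq> ?I \<inter> carrier ?A"
  proof -
    have "?S k \<subseteq> ?I"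
      unfolding rel_ideal_def by (rule B.genideal_self[OF hecke_rels_closed])
    with rels hecke_rels_closed[of 2 u1 u2 q] show ?thesis
      by (meson order_trans le_infI)
  qed
  ultimately have "Idl\<^bsub>?A\<^esub> (?S 2) \<subseteq> ?I \<inter> carrier ?A"
    by (rule A.genideal_minimal)
  then have "rel_ideal (hecke_gens 2) (hecke_rels 2 u1 u2 q) \<subseteq> ?I \<inter> carrier ?A"
    by (simp only: rel_ideal_def)
  then show ?thesis
    by (rule order_trans) (rule Int_lower1)
qed

definition hecke_alg ::
    "nat \<Rightarrow> complex \<Rightarrow> complex \<Rightarrow> complex \<Rightarrow> (complex, hecke_gen free set) module" where
  "hecke_alg k u1 u2 q = presented_alg (hecke_gens k) (hecke_rels k u1 u2 q)"

definition hecke_class ::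
    "nat \<Rightarrow> complex \<Rightarrow> complex \<Rightarrow> complex \<Rightarrow> hecke_gen free \<Rightarrow> hecke_gen free set" where
  "hecke_class k u1 u2 q = presented_class (hecke_gens k) (hecke_rels k u1 u2 q)"

text \<open>
  The canonical map from \<open>H\<^sub>2\<close> to \<open>H\<^sub>k\<close>, sending \<open>X\<^sub>1\<close> to \<open>X\<^sub>1\<close> and \<open>T\<^sub>1\<close> to \<open>T\<^sub>1\<close>,
  by which \<open>H\<^sub>2\<close> is regarded as a subalgebra of \<open>H\<^sub>k\<close>.  All members of a coset \<open>C\<close> of the
  smaller relation ideal have the same class in \<open>H\<^sub>k\<close>; see \<open>hecke_incl_class\<close> below.
\<close>

definition hecke_incl ::
    "nat \<Rightarrow> complex \<Rightarrow> complex \<Rightarrow> complex \<Rightarrow> hecke_gen free set \<Rightarrow> hecke_gen free set" where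
  "hecke_incl k u1 u2 q C = (\<Union>x\<in>C. hecke_class k u1 u2 q x)"

lemma hecke_incl_class:
  assumes "2 \<le> k" "x \<in> carrier (free_alg (hecke_gens 2))"
  shows "hecke_incl k u1 u2 q (hecke_class 2 u1 u2 q x) = hecke_class k u1 u2 q x"
proof -
  let ?A = "free_alg (hecke_gens 2)" and ?B = "free_alg (hecke_gens k)"
  let ?I = "rel_ideal (hecke_gens k) (hecke_rels k u1 u2 q)"
  let ?J = "rel_ideal (hecke_gens 2) (hecke_rels 2 u1 u2 q)"
  interpret A: ring ?A by (rule ring_free_alg)
  interpret B: ring ?B by (rule ring_free_alg)
  interpret I: ideal ?I ?B
    unfolding rel_ideal_def by (rule B.genideal_ideal[OF hecke_rels_closed])
  interpret J: ideal ?J ?A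
    unfolding rel_ideal_def by (rule A.genideal_ideal[OF hecke_rels_closed])
  have x: "x \<in> carrier ?B"
    using assms free_alg_mono[of "hecke_gens 2" "hecke_gens k"] by (auto simp: hecke_gens_def)
  have "?I +>\<^bsub>?B\<^esub> y = ?I +>\<^bsub>?B\<^esub> x" if "y \<in> ?J +>\<^bsub>?A\<^esub> x" for y
  proof -
    from that obtain i where "i \<in> ?J" "y = i + x"
      unfolding a_r_coset_def r_coset_def by (auto simp: free_alg_def)
    then have "y \<in> ?I +>\<^bsub>?B\<^esub> x"
      using rel_ideal_hecke_mono[OF assms(1)] unfolding a_r_coset_def r_coset_def
      by (auto simp: free_alg_def)
    then show ?thesis
      using B.a_repr_independence[OF _ x I.a_subgroup] by metis
  qed
  moreover have "x \<in> ?J +>\<^bsub>?A\<^esub> x"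
    using J.a_rcos_self assms(2) by blast
  ultimately show ?thesis
    unfolding hecke_incl_def hecke_class_def presented_class_def by blast
qed

text \<open>
  The conditions on \<open>\<rho>\<close> determine it on the whole of \<open>H\<^sub>2\<close>, so they single out the
  one-dimensional representation indexed by \<open>((1\<^sup>2), \<emptyset>)\<close>.
\<close>

definition hecke_sign_ideal :: "complex \<Rightarrow> complex \<Rightarrow> complex \<Rightarrow> hecke_gen free set set" where
  "hecke_sign_ideal u1 u2 q =
     (THE J. \<exists>\<rho> \<in> alg_hom (hecke_alg 2 u1 u2 q) (module_mat TYPE(complex) 1 1).
        \<rho> (hecke_class 2 u1 u2 q hX) = u1 \<cdot>\<^sub>m 1\<^sub>m 1 \<and>
        \<rho> (hecke_class 2 u1 u2 q (hT 1)) = (- inverse q) \<cdot>\<^sub>m 1\<^sub>m 1 \<and>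
        corresponding_minimal_ideal (hecke_alg 2 u1 u2 q) 1 \<rho> J)"

definition hecke_ideal ::
    "nat \<Rightarrow> complex \<Rightarrow> complex \<Rightarrow> complex \<Rightarrow> hecke_gen free set set" where
  "hecke_ideal k u1 u2 q =
     Idl\<^bsub>hecke_alg k u1 u2 q\<^esub> (hecke_incl k u1 u2 q ` hecke_sign_ideal u1 u2 q)"

end

theory Submission
  imports Defs "HOL-Computational_Algebra.Polynomial"
begin

text \<open>
  Put \<open>P\<^sub>1 = 1 - X\<^sub>1\<close>, an idempotent, and \<open>Y = P\<^sub>1 T\<^sub>1\<^sup>-\<^sup>1 P\<^sub>1\<close>.  The relation
  \<open>X\<^sub>1 T\<^sub>1 X\<^sub>1 T\<^sub>1 = T\<^sub>1 X\<^sub>1 T\<^sub>1 X\<^sub>1\<close> says that \<open>Y\<close> commutes with \<open>T\<^sub>1\<close> (\<open>commutator\<close>).  Therefore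
  \<open>z = Y (T\<^sub>1 - q)\<close> satisfies \<open>X\<^sub>1 z = z X\<^sub>1 = 0\<close> and \<open>T\<^sub>1 z = z T\<^sub>1 = -q\<^sup>-\<^sup>1 z\<close>: the algebra
  \<open>H\<^sub>2\<close> acts on \<open>z\<close> by the sign character (\<open>Z_absorbs\<close>).  In every \<open>H\<^sub>2\<close> one has \<open>z \<noteq> 0\<close> and
  \<open>z\<^sup>2 = (q\<^sup>2 + 1) z\<close>; as a semisimple algebra has no nilpotent ideals, \<open>q\<^sup>2 \<noteq> -1\<close>
  (\<open>semisimple_imp_q\<close>), and the line spanned by \<open>z\<close> is the minimal ideal of the sign representation
  (\<open>hecke_sign_ideal_eq\<close>).

  So \<open>H\<^sub>k / I\<close> arises from \<open>H\<^sub>k\<close> by imposing the single relation \<open>z = 0\<close>, that is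
  \<open>Y T\<^sub>1 = q Y\<close>.  In the rook monoid algebra \<open>P\<^sub>2 = q Y\<close>, and that relation is
  \<open>P\<^sub>2 T\<^sub>1 = q P\<^sub>2\<close>; hence there is a homomorphism from \<open>H\<^sub>k / I\<close> to the rook monoid algebra
  (\<open>rook_hecke_relations\<close>).  Conversely, in \<open>H\<^sub>k / I\<close> define
  \<open>P\<^sub>i\<^sub>+\<^sub>1 = q P\<^sub>i T\<^sub>i\<^sup>-\<^sup>1 P\<^sub>i\<close> by recursion.  All the relations of the rook monoid algebra follow by
  induction (\<open>rook_tower\<close>); the only one that is not inherited at once is
  \<open>T\<^sub>i P\<^sub>i\<^sub>+\<^sub>1 = q P\<^sub>i\<^sub>+\<^sub>1 = P\<^sub>i\<^sub>+\<^sub>1 T\<^sub>i\<close>, which the braid relation deduces from its predecessor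
  (\<open>braid_step\<close>) and which for \<open>i = 1\<close> is \<open>z = 0\<close>.  The two homomorphisms are inverse to each other
  because they are so on generators.
\<close>

section \<open>A tower of idempotents from the braid relations\<close>

lemma (in monoid) m_lcomm:
  assumes "x \<otimes> y = y \<otimes> x" "x \<in> carrier G" "y \<in> carrier G" "w \<in> carrier G"
  shows "x \<otimes> (y \<otimes> w) = y \<otimes> (x \<otimes> w)"
  using assms by (metis m_assoc)

text \<open>
  The step of the tower.  Think of \<open>U = T\<^sub>i\<^sup>-\<^sup>1\<close>, \<open>V = T\<^sub>i\<^sub>+\<^sub>1\<^sup>-\<^sup>1\<close>, \<open>P = P\<^sub>i\<close>, \<open>Q = P\<^sub>i\<^sub>+\<^sub>1\<close>,
  \<open>a = q\<close> and \<open>b = q\<^sup>-\<^sup>1\<close>; then \<open>P\<^sub>i\<^sub>+\<^sub>2 = q Q V Q\<close>.  Because \<open>P\<close> commutes with \<open>V\<close> and is absorbed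
  by \<open>Q\<close>, one has \<open>Q V Q = a P U V Q\<close>.  Multiplication by \<open>V\<close> on the left passes over \<open>P\<close>, and
  the braid relation turns \<open>V U V Q\<close> into \<open>U V U Q = b U V Q\<close>.  The other side is the mirror image.
\<close>
lemma (in monoid) braid_step:
  assumes carr: "a \<in> carrier G" "b \<in> carrier G" "P \<in> carrier G" "U \<in> carrier G" "V \<in> carrier G"
    and a: "\<And>x. x \<in> carrier G \<Longrightarrow> x \<otimes> a = a \<otimes> x"
    and b: "\<And>x. x \<in> carrier G \<Longrightarrow> x \<otimes> b = b \<otimes> x"
    and braid: "U \<otimes> V \<otimes> U = V \<otimes> U \<otimes> V"
    and PV: "P \<otimes> V = V \<otimes> P" and PP: "P \<otimes> P = P"
    and Q: "Q = a \<otimes> P \<otimes> U \<otimes> P"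
    and UQ: "U \<otimes> Q = b \<otimes> Q" and QU: "Q \<otimes> U = b \<otimes> Q"
  shows "V \<otimes> (Q \<otimes> V \<otimes> Q) = b \<otimes> (Q \<otimes> V \<otimes> Q)"
    and "(Q \<otimes> V \<otimes> Q) \<otimes> V = b \<otimes> (Q \<otimes> V \<otimes> Q)"
proof -
  have [simp]: "Q \<in> carrier G" using carr Q by simp
  note [simp] = carr
  have PQ: "P \<otimes> Q = Q"
    by (simp add: Q m_assoc m_lcomm[OF a]) (metis PP carr m_assoc m_closed)
  have QP: "Q \<otimes> P = Q"
    by (simp add: Q m_assoc PP)
  have 1: "Q \<otimes> V \<otimes> Q = a \<otimes> (P \<otimes> (U \<otimes> (V \<otimes> Q)))"
  proof -
    have "Q \<otimes> V \<otimes> Q = a \<otimes> (P \<otimes> (U \<otimes> (P \<otimes> (V \<otimes> Q))))" by (simp add: Q m_assoc)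
    then show ?thesis by (simp add: m_lcomm[OF PV] PQ)
  qed
  have 2: "Q \<otimes> V \<otimes> Q = a \<otimes> (Q \<otimes> (V \<otimes> (U \<otimes> P)))"
  proof -
    have "Q \<otimes> V \<otimes> Q = Q \<otimes> (V \<otimes> (a \<otimes> (P \<otimes> (U \<otimes> P))))"
      by (subst (2) Q) (simp add: m_assoc)
    also have "\<dots> = a \<otimes> (Q \<otimes> (V \<otimes> (P \<otimes> (U \<otimes> P))))" by (simp add: m_lcomm[OF a])
    also have "\<dots> = a \<otimes> (Q \<otimes> (P \<otimes> (V \<otimes> (U \<otimes> P))))" by (simp add: m_lcomm[OF PV])
    also have "\<dots> = a \<otimes> (Q \<otimes> (V \<otimes> (U \<otimes> P)))" by (metis QP carr m_assoc m_closed \<open>Q \<in> carrier G\<close>)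
    finally show ?thesis .
  qed
  have "V \<otimes> (Q \<otimes> V \<otimes> Q) = a \<otimes> (P \<otimes> (V \<otimes> (U \<otimes> (V \<otimes> Q))))"
    unfolding 1 by (simp add: m_lcomm[OF a] m_lcomm[OF PV])
  also have "V \<otimes> (U \<otimes> (V \<otimes> Q)) = U \<otimes> (V \<otimes> (U \<otimes> Q))"
    using arg_cong[OF braid, of "\<lambda>x. x \<otimes> Q"] by (simp add: m_assoc)
  also have "a \<otimes> (P \<otimes> \<dots>) = b \<otimes> (a \<otimes> (P \<otimes> (U \<otimes> (V \<otimes> Q))))"
    by (simp add: UQ m_lcomm[OF b])
  finally show "V \<otimes> (Q \<otimes> V \<otimes> Q) = b \<otimes> (Q \<otimes> V \<otimes> Q)" by (simp only: 1)
  have "(Q \<otimes> V \<otimes> Q) \<otimes> V = a \<otimes> (Q \<otimes> (V \<otimes> (U \<otimes> (V \<otimes> P))))"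
    unfolding 2 by (simp add: m_assoc PV)
  also have "V \<otimes> (U \<otimes> (V \<otimes> P)) = U \<otimes> (V \<otimes> (U \<otimes> P))"
    using arg_cong[OF braid, of "\<lambda>x. x \<otimes> P"] by (simp add: m_assoc)
  also have "Q \<otimes> \<dots> = (Q \<otimes> U) \<otimes> (V \<otimes> (U \<otimes> P))" by (simp add: m_assoc)
  also have "a \<otimes> \<dots> = b \<otimes> (a \<otimes> (Q \<otimes> (V \<otimes> (U \<otimes> P))))"
    by (simp add: QU m_assoc m_lcomm[OF b])
  finally show "(Q \<otimes> V \<otimes> Q) \<otimes> V = b \<otimes> (Q \<otimes> V \<otimes> Q)" by (simp only: 2)
qed

text \<open>
  The relation \<open>X T X T = T X T X\<close> says precisely that the element
  \<open>Y = (1 - X) T\<^sup>-\<^sup>1 (1 - X)\<close> commutes with \<open>T\<close>.  The quadratic relation makes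
  \<open>T - d\<close> the inverse of \<open>T\<close>.
\<close>
lemma (in ring) commutator:
  assumes carr [simp]: "X \<in> carrier R" "T \<in> carrier R" "d \<in> carrier R"
    and d: "\<And>x. x \<in> carrier R \<Longrightarrow> x \<otimes> d = d \<otimes> x"
    and XX: "X \<otimes> X = X" and TT: "T \<otimes> T = d \<otimes> T \<oplus> \<one>"
    and Y: "Y = (\<one> \<ominus> X) \<otimes> (T \<ominus> d) \<otimes> (\<one> \<ominus> X)"
  shows "Y \<otimes> T \<ominus> T \<otimes> Y = X \<otimes> T \<otimes> X \<otimes> T \<ominus> T \<otimes> X \<otimes> T \<otimes> X"
proof -
  have 1: "(T \<ominus> d) \<otimes> T = \<one>" "T \<otimes> (T \<ominus> d) = \<one>"
  proof -
    have "(T \<ominus> d) \<otimes> T = T \<otimes> T \<ominus> d \<otimes> T" using carr by algebra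
    then show "(T \<ominus> d) \<otimes> T = \<one>" unfolding TT using carr by algebra
    have "T \<otimes> (T \<ominus> d) = T \<otimes> T \<ominus> T \<otimes> d" using carr by algebra
    then show "T \<otimes> (T \<ominus> d) = \<one>" unfolding TT d[OF carr(2)] using carr by algebra
  qed
  have "Y \<otimes> T = (T \<ominus> d) \<otimes> T \<ominus> X \<otimes> ((T \<ominus> d) \<otimes> T) \<ominus> T \<otimes> X \<otimes> T \<oplus> d \<otimes> X \<otimes> T
      \<oplus> X \<otimes> T \<otimes> X \<otimes> T \<ominus> (X \<otimes> d) \<otimes> X \<otimes> T" unfolding Y using carr by algebra
  also have "\<dots> = \<one> \<ominus> X \<ominus> T \<otimes> X \<otimes> T \<oplus> d \<otimes> X \<otimes> T
      \<oplus> X \<otimes> T \<otimes> X \<otimes> T \<ominus> d \<otimes> (X \<otimes> X) \<otimes> T" by (simp add: 1 d m_assoc)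
  finally have YT: "Y \<otimes> T = \<one> \<ominus> X \<ominus> T \<otimes> X \<otimes> T \<oplus> X \<otimes> T \<otimes> X \<otimes> T"
    unfolding XX using carr by (algebra)
  have "T \<otimes> Y = T \<otimes> (T \<ominus> d) \<ominus> (T \<otimes> (T \<ominus> d)) \<otimes> X \<ominus> T \<otimes> X \<otimes> T \<oplus> (T \<otimes> X) \<otimes> d
      \<oplus> T \<otimes> X \<otimes> T \<otimes> X \<ominus> T \<otimes> X \<otimes> (d \<otimes> X)" unfolding Y using carr by (algebra, simp)
  also have "\<dots> = \<one> \<ominus> X \<ominus> T \<otimes> X \<otimes> T \<oplus> T \<otimes> X \<otimes> d
      \<oplus> T \<otimes> X \<otimes> T \<otimes> X \<ominus> T \<otimes> (X \<otimes> X) \<otimes> d" by (simp add: 1 d[symmetric] m_assoc)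
  finally have TY: "T \<otimes> Y = \<one> \<ominus> X \<ominus> T \<otimes> X \<otimes> T \<oplus> T \<otimes> X \<otimes> T \<otimes> X"
    unfolding XX using carr by algebra
  show ?thesis unfolding YT TY using carr by algebra
qed

lemma (in ring) minus_eq_zero_iff:
  "x \<in> carrier R \<Longrightarrow> y \<in> carrier R \<Longrightarrow> x \<ominus> y = \<zero> \<longleftrightarrow> x = y"
  by (metis add.inv_solve_right l_zero zero_closed minus_eq)

lemma (in ring) complement_complement: "x \<in> carrier R \<Longrightarrow> \<one> \<ominus> (\<one> \<ominus> x) = x"
  by (simp add: minus_eq minus_add r_neg2)

lemma (in ring) complement_idem:
  assumes x: "x \<in> carrier R" "x \<otimes> x = x"
  shows "(\<one> \<ominus> x) \<otimes> (\<one> \<ominus> x) = \<one> \<ominus> x"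
  using x by (simp add: minus_eq l_distr r_distr l_minus r_minus l_neg r_neg a_ac)

text \<open>
  The part of the defining relations of the rook monoid algebra from which the others follow:
  only the first projection \<open>P 1\<close> is subject to conditions of its own, the later ones are
  defined from it by recursion, and absorption of \<open>T j\<close> is demanded for \<open>P 2\<close> alone.
  Here \<open>a\<close> and \<open>b\<close> stand for \<open>q\<close> and its inverse.
\<close>
locale rook_tower = ring R for R (structure) +
  fixes a b :: 'a and T :: "nat \<Rightarrow> 'a" and P :: "nat \<Rightarrow> 'a" and k :: nat
  assumes ab_closed [simp]: "a \<in> carrier R" "b \<in> carrier R"
    and a_central: "x \<in> carrier R \<Longrightarrow> x \<otimes> a = a \<otimes> x"
    and b_central: "x \<in> carrier R \<Longrightarrow> x \<otimes> b = b \<otimes> x"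
    and ab: "a \<otimes> b = \<one>"
    and T_closed [simp]: "1 \<le> i \<Longrightarrow> i < k \<Longrightarrow> T i \<in> carrier R"
    and quadratic: "1 \<le> i \<Longrightarrow> i < k \<Longrightarrow> T i \<otimes> T i = (a \<ominus> b) \<otimes> T i \<oplus> \<one>"
    and braid: "1 \<le> i \<Longrightarrow> Suc i < k \<Longrightarrow>
      T i \<otimes> T (Suc i) \<otimes> T i = T (Suc i) \<otimes> T i \<otimes> T (Suc i)"
    and P_closed [simp]: "1 \<le> i \<Longrightarrow> i \<le> k \<Longrightarrow> P i \<in> carrier R"
    and P1_idem: "P 1 \<otimes> P 1 = P 1"
    and P1_comm: "2 \<le> j \<Longrightarrow> j < k \<Longrightarrow> P 1 \<otimes> T j = T j \<otimes> P 1"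
    and far: "1 \<le> i \<Longrightarrow> i < k \<Longrightarrow> 1 \<le> j \<Longrightarrow> j < k \<Longrightarrow> Suc i < j \<Longrightarrow> T i \<otimes> T j = T j \<otimes> T i"
    and P_Suc: "1 \<le> i \<Longrightarrow> i < k \<Longrightarrow> P (Suc i) = a \<otimes> P i \<otimes> (T i \<ominus> (a \<ominus> b)) \<otimes> P i"
    and P2: "1 < k \<Longrightarrow> T 1 \<otimes> P 2 = a \<otimes> P 2" "1 < k \<Longrightarrow> P 2 \<otimes> T 1 = a \<otimes> P 2"
begin

abbreviation "U i \<equiv> T i \<ominus> (a \<ominus> b)"

lemma d_central: "x \<in> carrier R \<Longrightarrow> x \<otimes> (a \<ominus> b) = (a \<ominus> b) \<otimes> x"
proof -
  assume x: "x \<in> carrier R"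
  have "x \<otimes> (a \<ominus> b) = x \<otimes> a \<ominus> x \<otimes> b" using x ab_closed by algebra
  also have "\<dots> = (a \<ominus> b) \<otimes> x"
    unfolding a_central[OF x] b_central[OF x] using x ab_closed by algebra
  finally show ?thesis .
qed

lemma U_inverse:
  assumes "1 \<le> i" "i < k"
  shows "U i \<otimes> T i = \<one>" "T i \<otimes> U i = \<one>"
proof -
  have t: "T i \<in> carrier R" using assms by simp
  have "U i \<otimes> T i = T i \<otimes> T i \<ominus> (a \<ominus> b) \<otimes> T i" using t ab_closed by algebra
  then show "U i \<otimes> T i = \<one>" unfolding quadratic[OF assms] using t ab_closed by algebra
  have "T i \<otimes> U i = T i \<otimes> T i \<ominus> T i \<otimes> (a \<ominus> b)" using t ab_closed by algebra
  then show "T i \<otimes> U i = \<one>" unfolding quadratic[OF assms] d_central[OF t]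
    using t ab_closed by algebra
qed

lemma U_comm:
  assumes "1 \<le> j" "j < k" "x \<in> carrier R" "x \<otimes> T j = T j \<otimes> x"
  shows "x \<otimes> U j = U j \<otimes> x"
proof -
  have t: "T j \<in> carrier R" using assms by simp
  have "x \<otimes> U j = x \<otimes> T j \<ominus> x \<otimes> (a \<ominus> b)" using t assms(3) ab_closed by algebra
  also have "\<dots> = U j \<otimes> x"
    unfolding assms(4) d_central[OF assms(3)] using t assms(3) ab_closed by algebra
  finally show ?thesis .
qed

lemma U_braid:
  assumes "1 \<le> i" "Suc i < k"
  shows "U i \<otimes> U (Suc i) \<otimes> U i = U (Suc i) \<otimes> U i \<otimes> U (Suc i)"
proof -
  have [simp]: "T i \<in> carrier R" "T (Suc i) \<in> carrier R" using assms by auto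
  have inv: "U i \<otimes> T i = \<one>" "T i \<otimes> U i = \<one>"
    "U (Suc i) \<otimes> T (Suc i) = \<one>" "T (Suc i) \<otimes> U (Suc i) = \<one>"
    using U_inverse[of i] U_inverse[of "Suc i"] assms by auto
  have inv': "U i \<otimes> (T i \<otimes> x) = x" "T i \<otimes> (U i \<otimes> x) = x"
    "U (Suc i) \<otimes> (T (Suc i) \<otimes> x) = x" "T (Suc i) \<otimes> (U (Suc i) \<otimes> x) = x"
    if [simp]: "x \<in> carrier R" for x
    by (simp_all add: m_assoc[symmetric] inv)
  have "(U i \<otimes> U (Suc i) \<otimes> U i) \<otimes> (T i \<otimes> T (Suc i) \<otimes> T i) = \<one>"
    by (simp add: m_assoc inv inv')
  moreover have "(T (Suc i) \<otimes> T i \<otimes> T (Suc i)) \<otimes> (U (Suc i) \<otimes> U i \<otimes> U (Suc i)) = \<one>"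
    by (simp add: m_assoc inv inv')
  ultimately show ?thesis
    using inv_unique[of "U i \<otimes> U (Suc i) \<otimes> U i" "T i \<otimes> T (Suc i) \<otimes> T i"
        "U (Suc i) \<otimes> U i \<otimes> U (Suc i)"] braid[OF assms] by simp
qed

lemma U_absorb:
  assumes "1 \<le> j" "j < k" "x \<in> carrier R"
  shows "T j \<otimes> x = a \<otimes> x \<longleftrightarrow> U j \<otimes> x = b \<otimes> x"
    and "x \<otimes> T j = a \<otimes> x \<longleftrightarrow> x \<otimes> U j = b \<otimes> x"
proof -
  have [simp]: "T j \<in> carrier R" "x \<in> carrier R" using assms by auto
  have ba: "b \<otimes> a = \<one>" using ab b_central by simp
  have ab': "a \<otimes> (b \<otimes> x) = x" "b \<otimes> (a \<otimes> x) = x"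
    by (simp_all add: m_assoc[symmetric] ab ba)
  note inv = U_inverse[OF assms(1,2)]
  have inv': "U j \<otimes> (T j \<otimes> x) = x" "T j \<otimes> (U j \<otimes> x) = x"
    by (simp_all add: m_assoc[symmetric] inv)
  have inv'': "x \<otimes> T j \<otimes> U j = x" "x \<otimes> U j \<otimes> T j = x"
    by (simp_all add: m_assoc inv)
  show "T j \<otimes> x = a \<otimes> x \<longleftrightarrow> U j \<otimes> x = b \<otimes> x"
  proof
    assume "T j \<otimes> x = a \<otimes> x"
    then have "b \<otimes> (U j \<otimes> (T j \<otimes> x)) = b \<otimes> (a \<otimes> (U j \<otimes> x))"
      by (simp add: m_lcomm[OF a_central])
    then show "U j \<otimes> x = b \<otimes> x" by (simp add: inv' m_assoc[symmetric] ba)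
  next
    assume "U j \<otimes> x = b \<otimes> x"
    then have "a \<otimes> (T j \<otimes> (U j \<otimes> x)) = a \<otimes> (b \<otimes> (T j \<otimes> x))"
      by (simp add: m_lcomm[OF b_central])
    then show "T j \<otimes> x = a \<otimes> x" by (simp add: inv' m_assoc[symmetric] ab)
  qed
  show "x \<otimes> T j = a \<otimes> x \<longleftrightarrow> x \<otimes> U j = b \<otimes> x"
  proof
    assume "x \<otimes> T j = a \<otimes> x"
    then have "b \<otimes> (x \<otimes> T j \<otimes> U j) = b \<otimes> (a \<otimes> (x \<otimes> U j))"
      by (simp add: m_assoc)
    then show "x \<otimes> U j = b \<otimes> x" by (simp add: inv'' m_assoc[symmetric] ba)
  next
    assume "x \<otimes> U j = b \<otimes> x"
    then have "a \<otimes> (x \<otimes> U j \<otimes> T j) = a \<otimes> (b \<otimes> (x \<otimes> T j))"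
      by (simp add: m_assoc)
    then show "x \<otimes> T j = a \<otimes> x" by (simp add: inv'' m_assoc[symmetric] ab)
  qed
qed

lemma P_comm: "1 \<le> i \<Longrightarrow> i < j \<Longrightarrow> j < k \<Longrightarrow> P i \<otimes> T j = T j \<otimes> P i"
proof (induction i rule: nat_induct_at_least)
  case base
  then show ?case using P1_comm[of j] by simp
next
  case (Suc i)
  have [simp]: "P i \<in> carrier R" "T i \<in> carrier R" "T j \<in> carrier R" using Suc by auto
  have P: "P i \<otimes> T j = T j \<otimes> P i" using Suc by simp
  have U: "U i \<otimes> T j = T j \<otimes> U i"
    using U_comm[of i "T j"] far[of i j] Suc by simp
  show ?case
    using Suc by (simp add: P_Suc m_assoc P U m_lcomm[OF P] m_lcomm[OF U] m_lcomm[OF a_central])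
qed

text \<open>
  Absorption of \<open>T j\<close> by \<open>P n\<close>, idempotency and \<open>P j P n = P n\<close> are proved together.  As
  \<open>P (i + 1) = a P i U i P i\<close> begins and ends with \<open>P i\<close>, everything is inherited from \<open>P i\<close>
  except absorption of \<open>T i\<close>, which is \<open>braid_step\<close>; idempotency follows from
  \<open>P (i + 1) P (i + 1) = a P i U i P (i + 1) = a b P (i + 1)\<close>.
\<close>
lemma P_props:
  "1 \<le> i \<Longrightarrow> i \<le> k \<Longrightarrow> P i \<otimes> P i = P i \<and>
    (\<forall>j. 1 \<le> j \<and> j < i \<longrightarrow> T j \<otimes> P i = a \<otimes> P i \<and> P i \<otimes> T j = a \<otimes> P i) \<and>
    (\<forall>j. 1 \<le> j \<and> j < i \<longrightarrow> P j \<otimes> P i = P i \<and> P i \<otimes> P j = P i)"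
proof (induction i rule: less_induct)
  \<comment> \<open>Course-of-values induction, as the braid argument for \<open>P (i + 2)\<close> goes back to \<open>P i\<close>.\<close>
  case (less n)
  show ?case
  proof (cases "n = 1")
    case True
    then show ?thesis using P1_idem by simp
  next
    case False
    then obtain i where n: "n = Suc i" and i: "1 \<le> i" "i < k" using less.prems by (cases n) auto
    have [simp]: "P i \<in> carrier R" "T i \<in> carrier R" "P n \<in> carrier R" using less.prems i n by auto
    have idem: "P i \<otimes> P i = P i" using less.IH[of i] i n by simp
    have IHT: "T j \<otimes> P i = a \<otimes> P i" "P i \<otimes> T j = a \<otimes> P i" if "1 \<le> j" "j < i" for j
      using that less.IH[of i] i n by auto
    have IHP: "P j \<otimes> P i = P i" "P i \<otimes> P j = P i" if "1 \<le> j" "j < i" for j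
      using that less.IH[of i] i n by auto
    have S: "P n = a \<otimes> (P i \<otimes> U i \<otimes> P i)"
      using P_Suc[OF i] n by (simp add: m_assoc)
    have left: "P i \<otimes> P n = P n" and right: "P n \<otimes> P i = P n"
    proof -
      have "P i \<otimes> P n = a \<otimes> (P i \<otimes> P i \<otimes> U i \<otimes> P i)"
        by (simp add: S m_assoc m_lcomm[OF a_central])
      then show "P i \<otimes> P n = P n" by (simp add: idem S)
      show "P n \<otimes> P i = P n" by (simp add: S m_assoc idem)
    qed
    have top: "U i \<otimes> P n = b \<otimes> P n \<and> P n \<otimes> U i = b \<otimes> P n"
    proof (cases "i = 1")
      case True
      then have n2: "n = 2" using n by simp
      then show ?thesis using P2 U_absorb[of 1 "P 2"] i True \<open>P n \<in> carrier R\<close> by simp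
    next
      case False
      then obtain m where m: "i = Suc m" "1 \<le> m" using i by (cases i) auto
      have [simp]: "T m \<in> carrier R" "P m \<in> carrier R" using m i by auto
      have mm: "P m \<otimes> P m = P m" using less.IH[of m] m n i by simp
      have UV: "U m \<otimes> U i \<otimes> U m = U i \<otimes> U m \<otimes> U i" using U_braid[of m] m i by simp
      have PV: "P m \<otimes> U i = U i \<otimes> P m" using U_comm[of i "P m"] P_comm[of m i] m i by simp
      have PQ: "P i = a \<otimes> P m \<otimes> U m \<otimes> P m" using P_Suc[of m] m i by simp
      have UQ: "U m \<otimes> P i = b \<otimes> P i" "P i \<otimes> U m = b \<otimes> P i"
        using U_absorb[of m "P i"] IHT[of m] m i by simp_all
      have "U i \<otimes> (P i \<otimes> U i \<otimes> P i) = b \<otimes> (P i \<otimes> U i \<otimes> P i)"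
        by (rule braid_step(1)[OF _ _ _ _ _ a_central b_central UV PV mm PQ UQ]) simp_all
      moreover have "(P i \<otimes> U i \<otimes> P i) \<otimes> U i = b \<otimes> (P i \<otimes> U i \<otimes> P i)"
        by (rule braid_step(2)[OF _ _ _ _ _ a_central b_central UV PV mm PQ UQ]) simp_all
      ultimately show ?thesis
        unfolding S m_lcomm[OF b_central[OF ab_closed(1), symmetric] ab_closed(2) ab_closed(1)]
        by (simp add: m_lcomm[OF a_central] m_assoc[of a])
    qed
    have T: "T j \<otimes> P n = a \<otimes> P n \<and> P n \<otimes> T j = a \<otimes> P n" if "1 \<le> j" "j < n" for j
    proof (cases "j = i")
      case True
      then show ?thesis using top U_absorb[of i "P n"] i by simp
    next
      case False
      then have j: "1 \<le> j" "j < i" using that n by auto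
      then have [simp]: "T j \<in> carrier R" using i by simp
      have "T j \<otimes> P n = T j \<otimes> P i \<otimes> P n" by (simp add: m_assoc left)
      also have "\<dots> = a \<otimes> P n" by (simp only: IHT[OF j]) (simp add: m_assoc left)
      finally have 1: "T j \<otimes> P n = a \<otimes> P n" .
      have "P n \<otimes> T j = P n \<otimes> (P i \<otimes> T j)" by (simp add: m_assoc[symmetric] right)
      also have "\<dots> = a \<otimes> P n"
        by (simp only: IHT[OF j]) (simp add: m_lcomm[OF a_central] right)
      finally show ?thesis using 1 by simp
    qed
    have PP: "P j \<otimes> P n = P n \<and> P n \<otimes> P j = P n" if "1 \<le> j" "j < n" for j
    proof (cases "j = i")
      case True
      then show ?thesis using left right by simp
    next
      case False
      then have j: "1 \<le> j" "j < i" using that n by auto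
      then have [simp]: "P j \<in> carrier R" using i by simp
      have "P j \<otimes> P n = P j \<otimes> P i \<otimes> P n" by (simp add: m_assoc left)
      moreover have "P n \<otimes> P j = P n \<otimes> (P i \<otimes> P j)" by (simp add: m_assoc[symmetric] right)
      ultimately show ?thesis using IHP[OF j] left right by simp
    qed
    have "P n \<otimes> P n = a \<otimes> (P i \<otimes> (U i \<otimes> (P i \<otimes> P n)))"
      by (subst (1) S) (simp add: m_assoc)
    also have "\<dots> = a \<otimes> b \<otimes> P n"
      using top by (simp add: left m_lcomm[OF b_central] m_assoc)
    finally have "P n \<otimes> P n = P n" by (simp add: ab)
    then show ?thesis using T PP by blast
  qed
qed

lemma P_mult:
  assumes "1 \<le> i" "i \<le> k" "1 \<le> j" "j \<le> k"
  shows "P i \<otimes> P j = P (max i j)"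
  using assms P_props[of i] P_props[of j]
  by (cases i j rule: linorder_cases) (auto simp: max_def)

end

section \<open>Homomorphisms from free and presented algebras\<close>

lemma free_alg_simps [simp]:
  "x \<otimes>\<^bsub>free_alg G\<^esub> y = x * y" "x \<oplus>\<^bsub>free_alg G\<^esub> y = x + y"
  "\<one>\<^bsub>free_alg G\<^esub> = 1" "\<zero>\<^bsub>free_alg G\<^esub> = 0" "c \<odot>\<^bsub>free_alg G\<^esub> x = scal c * x"
  by (simp_all add: free_alg_def)

lemma scal_simps:
  "scal c * scal d = scal (c * d)" "scal c + scal d = scal (c + d)" "scal 0 = 0" "scal 1 = 1"
  "scal c - scal d = scal (c - d)"
  by (simp_all add: scal_def mult_single plus_list_def single_add single_diff)
    (simp add: zero_list_def [symmetric])

lemma update_eq_add_single: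
  fixes e :: "'b :: monoid_add"
  assumes "w \<notin> Poly_Mapping.keys f"
  shows "Poly_Mapping.update w e f = f + Poly_Mapping.single w e"
  using assms
  by (intro poly_mapping_eqI) (auto simp: lookup_update lookup_add lookup_single when_def in_keys_iff)

lemma single_induct [case_names zero add]:
  assumes "P 0" "\<And>p w c. P p \<Longrightarrow> P (p + Poly_Mapping.single w c)"
  shows "P p"
proof (induction p rule: update_induct)
  case const
  then show ?case using assms(1) by simp
next
  case (update f w e)
  then show ?case
    unfolding update_eq_add_single[OF update.hyps(1)] by (intro assms(2))
qed

lemma scal_central: "x * scal c = scal c * x"
proof (induction x rule: single_induct)
  case (add x w e)
  then show ?case
    by (simp add: distrib_left distrib_right scal_def mult_single plus_list_def mult.commute)
qed simp

text \<open>
  The homomorphism given by the universal property of the free algebra.  The ground field acts on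
  the target through \<open>s\<close>, so the target can be any type of rings; homomorphisms into
  rings with a carrier are obtained by composing with a class map.
\<close>
definition eval :: "(complex \<Rightarrow> 'b) \<Rightarrow> ('g \<Rightarrow> 'b) \<Rightarrow> 'g free \<Rightarrow> 'b :: ring_1" where
  "eval s f p = (\<Sum>w \<in> Poly_Mapping.keys p. s (Poly_Mapping.lookup p w) * prod_list (map f w))"

locale scalar_hom =
  fixes s :: "complex \<Rightarrow> 'b :: ring_1"
  assumes s_add: "s (c + d) = s c + s d"
    and s_mult: "s (c * d) = s c * s d"
    and s_one: "s 1 = 1"
    and s_central: "x * s c = s c * x"
begin

lemma s_zero: "s 0 = 0"
  using s_add[of 0 0] by simp

lemma eval_superset:
  assumes "finite A" "Poly_Mapping.keys p \<subseteq> A"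
  shows "eval s f p = (\<Sum>w\<in>A. s (Poly_Mapping.lookup p w) * prod_list (map f w))"
  unfolding eval_def using assms
  by (intro sum.mono_neutral_left) (auto simp: s_zero in_keys_iff)

lemma eval_add: "eval s f (p + r) = eval s f p + eval s f r"
proof -
  let ?A = "Poly_Mapping.keys p \<union> Poly_Mapping.keys r"
  have "Poly_Mapping.keys (p + r) \<subseteq> ?A" by (rule keys_add)
  then show ?thesis
    by (simp add: eval_superset[of ?A] lookup_add s_add distrib_right sum.distrib)
qed

lemma eval_zero: "eval s f 0 = 0"
  by (simp add: eval_def)

lemma eval_single: "eval s f (Poly_Mapping.single w c) = s c * prod_list (map f w)"
  by (simp add: eval_superset[of "{w}"])

lemma eval_mult: "eval s f (p * r) = eval s f p * eval s f r"
proof (induction p rule: single_induct)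
  case zero
  then show ?case by (simp add: eval_zero)
next
  case (add p w c)
  have "eval s f (Poly_Mapping.single w c * r) = eval s f (Poly_Mapping.single w c) * eval s f r"
  proof (induction r rule: single_induct)
    case (add r v e)
    have "s c * s e * (prod_list (map f w) * prod_list (map f v))
        = s c * prod_list (map f w) * (s e * prod_list (map f v))"
      by (metis s_central mult.assoc)
    then show ?case
      using add by (simp add: distrib_left eval_add mult_single plus_list_def eval_single s_mult)
  qed (simp add: eval_zero)
  then show ?case
    using add by (simp add: distrib_right eval_add)
qed

lemma eval_one: "eval s f 1 = 1"
proof -
  have "eval s f (Poly_Mapping.single [] 1) = 1" by (simp add: eval_single s_one)
  then show ?thesis by (simp add: zero_list_def [symmetric])
qed

lemma eval_scal: "eval s f (scal c) = s c"
  by (simp add: scal_def eval_single)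

lemma eval_gen: "eval s f (gen g) = f g"
  by (simp add: gen_def eval_single s_one)

lemma eval_diff: "eval s f (p - r) = eval s f p - eval s f r"
  using eval_add[of f "p - r" r] by (simp add: algebra_simps)

lemmas eval_simps =
  eval_add eval_mult eval_zero eval_one eval_scal eval_gen eval_diff

end

interpretation scal: scalar_hom scal
  by standard (simp_all add: scal_simps, rule scal_central)

lemma scalar_hom_id: "scalar_hom (\<lambda>c. c :: complex)"
  by unfold_locales auto

lemma scalar_hom_const_poly: "scalar_hom (\<lambda>c. [:c:] :: complex poly)"
proof
  show "x * [:c:] = [:c:] * x" for c and x :: "complex poly" by (rule mult.commute)
qed (simp_all add: one_pCons)

lemma free_alg_induct [consumes 1, case_names scal gen add mult]:
  assumes "p \<in> carrier (free_alg G)"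
    and scal: "\<And>c. Q (scal c)"
    and gen: "\<And>g. g \<in> G \<Longrightarrow> Q (gen g)"
    and add: "\<And>p r. p \<in> carrier (free_alg G) \<Longrightarrow> r \<in> carrier (free_alg G) \<Longrightarrow>
      Q p \<Longrightarrow> Q r \<Longrightarrow> Q (p + r)"
    and mult: "\<And>p r. p \<in> carrier (free_alg G) \<Longrightarrow> r \<in> carrier (free_alg G) \<Longrightarrow>
      Q p \<Longrightarrow> Q r \<Longrightarrow> Q (p * r)"
  shows "Q p"
proof -
  have single: "Q (Poly_Mapping.single w c) \<and> Poly_Mapping.single w c \<in> carrier (free_alg G)"
    if "set w \<subseteq> G" for w c
    using that
  proof (induction w)
    case Nil
    then show ?case using scal[of c] free_alg_closed(6)[of c G] by (simp add: scal_def)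
  next
    case (Cons g w)
    have "Poly_Mapping.single (g # w) c = gen g * Poly_Mapping.single w c"
      by (simp add: gen_def mult_single plus_list_def)
    then show ?case
      using Cons gen[of g] mult free_alg_closed(7)[of g G] by (simp add: free_alg_closed(2))
  qed
  have "(\<forall>w \<in> Poly_Mapping.keys p. set w \<subseteq> G) \<longrightarrow> Q p"
  proof (induction p rule: update_induct)
    case const
    then show ?case using scal[of 0] by (simp add: scal_simps)
  next
    case (update f w e)
    note eq = update_eq_add_single[OF update.hyps(1), of e]
    show ?case
    proof
      assume "\<forall>v \<in> Poly_Mapping.keys (Poly_Mapping.update w e f). set v \<subseteq> G"
      then have "set w \<subseteq> G" and "\<forall>v \<in> Poly_Mapping.keys f. set v \<subseteq> G"
        using update.hyps by (auto simp: keys_update)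
      then show "Q (Poly_Mapping.update w e f)"
        unfolding eq using update.IH single by (intro add) (auto simp: free_alg_def)
    qed
  qed
  then show ?thesis using assms(1) by (simp add: free_alg_def)
qed

lemma eval_closed:
  assumes "p \<in> carrier (free_alg G)" "\<And>g. g \<in> G \<Longrightarrow> f g \<in> carrier (free_alg H)"
  shows "eval scal f p \<in> carrier (free_alg H)"
  using assms(1)
  by (induction rule: free_alg_induct)
    (auto simp: scal.eval_simps free_alg_closed assms(2))

lemma free_alg_idealI:
  assumes "M \<subseteq> carrier (free_alg G)" "0 \<in> M"
    and "\<And>x y. x \<in> M \<Longrightarrow> y \<in> M \<Longrightarrow> x + y \<in> M"
    and l: "\<And>a x. a \<in> carrier (free_alg G) \<Longrightarrow> x \<in> M \<Longrightarrow> a * x \<in> M"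
    and "\<And>a x. a \<in> carrier (free_alg G) \<Longrightarrow> x \<in> M \<Longrightarrow> x * a \<in> M"
  shows "ideal M (free_alg G)"
proof -
  interpret ring "free_alg G" by (rule ring_free_alg)
  show ?thesis
  proof (rule idealI)
    show "subgroup M (add_monoid (free_alg G))"
    proof (rule add.subgroupI)
      show "\<ominus>\<^bsub>free_alg G\<^esub> x \<in> M" if "x \<in> M" for x
      proof -
        have "scal (-1) * x + x = (scal (-1) + scal 1) * x"
          by (simp only: distrib_right scal_simps(4) mult_1_left)
        also have "\<dots> = 0" unfolding scal_simps(2) by (simp add: scal_simps)
        finally have "\<ominus>\<^bsub>free_alg G\<^esub> x = scal (-1) * x"
          using that assms(1) by (intro minus_equality) (auto simp: free_alg_closed)
        then show ?thesis using l[OF free_alg_closed(6) that] by simp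
      qed
    qed (use assms in auto)
  qed (use assms ring_axioms in auto)
qed

lemma rel_ideal_minimal:
  assumes "ideal M (free_alg G)" "\<And>l r. (l, r) \<in> Rel \<Longrightarrow> l - r \<in> M"
  shows "rel_ideal G Rel \<subseteq> M"
  unfolding rel_ideal_def
  by (rule ring.genideal_minimal[OF ring_free_alg assms(1)]) (use assms(2) in auto)

text \<open>
  In all algebras that occur here, a scalar acts as multiplication by an element of the algebra.
  This property passes to quotients by two-sided ideals, and it is what makes the scalar
  multiplication of a quotient, a union over a coset, well defined.
\<close>
definition has_scalars :: "(complex, 'a) module \<Rightarrow> (complex \<Rightarrow> 'a) \<Rightarrow> bool" where
  "has_scalars A s \<longleftrightarrow>
     ring A \<and> (\<forall>c. s c \<in> carrier A) \<and> (\<forall>c. \<forall>x \<in> carrier A. c \<odot>\<^bsub>A\<^esub> x = s c \<otimes>\<^bsub>A\<^esub> x)"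

lemma has_scalars_free_alg: "has_scalars (free_alg G) scal"
  by (simp add: has_scalars_def ring_free_alg free_alg_closed)

lemma alg_quot_simps [simp]:
  "carrier (alg_quot A I) = carrier (A Quot I)"
  "x \<otimes>\<^bsub>alg_quot A I\<^esub> y = x \<otimes>\<^bsub>A Quot I\<^esub> y" "x \<oplus>\<^bsub>alg_quot A I\<^esub> y = x \<oplus>\<^bsub>A Quot I\<^esub> y"
  "\<one>\<^bsub>alg_quot A I\<^esub> = \<one>\<^bsub>A Quot I\<^esub>" "\<zero>\<^bsub>alg_quot A I\<^esub> = \<zero>\<^bsub>A Quot I\<^esub>"
  "c \<odot>\<^bsub>alg_quot A I\<^esub> C = (\<Union>x\<in>C. I +>\<^bsub>A\<^esub> (c \<odot>\<^bsub>A\<^esub> x))"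
  by (simp_all add: alg_quot_def ring.extend_def module.fields_def)

lemma coset_eq_iff:
  assumes "ideal I A" "x \<in> carrier A" "y \<in> carrier A"
  shows "I +>\<^bsub>A\<^esub> x = I +>\<^bsub>A\<^esub> y \<longleftrightarrow> x \<ominus>\<^bsub>A\<^esub> y \<in> I"
proof -
  interpret ideal I A by (rule assms(1))
  show ?thesis using quotient_eq_iff_same_a_r_cos[OF assms] by simp
qed

lemma alg_quot_hom:
  assumes A: "has_scalars A s" and I: "ideal I A"
  shows "(+>\<^bsub>A\<^esub>) I \<in> alg_hom A (alg_quot A I)"
    and "(+>\<^bsub>A\<^esub>) I ` carrier A = carrier (alg_quot A I)"
    and "ring (alg_quot A I)"
    and "has_scalars (alg_quot A I) (\<lambda>c. I +>\<^bsub>A\<^esub> s c)"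
proof -
  interpret ideal I A by (rule I)
  have s: "s c \<in> carrier A" "x \<in> carrier A \<Longrightarrow> c \<odot>\<^bsub>A\<^esub> x = s c \<otimes>\<^bsub>A\<^esub> x" for c x
    using A by (auto simp: has_scalars_def)
  show surj: "(+>\<^bsub>A\<^esub>) I ` carrier A = carrier (alg_quot A I)"
    by (auto simp: FactRing_def A_RCOSETS_def' )
  have hom: "(+>\<^bsub>A\<^esub>) I \<in> Ring.ring_hom A (A Quot I)" by (rule rcos_ring_hom)
  have hom': "(+>\<^bsub>A\<^esub>) I \<in> Ring.ring_hom A (alg_quot A I)"
    using hom by (simp add: Ring.ring_hom_def)
  interpret Q: ring "A Quot I" by (rule quotient_is_ring)
  have "abelian_group (alg_quot A I)"
    by (rule abelian_groupI) (use Q.add.l_inv_ex in \<open>auto simp: Q.a_ac\<close>)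
  moreover have "monoid (alg_quot A I)"
    by (rule monoidI) (auto simp: Q.m_assoc)
  ultimately show ring': "ring (alg_quot A I)"
    by (rule ringI) (auto simp: Q.l_distr Q.r_distr)
  have smult: "c \<odot>\<^bsub>alg_quot A I\<^esub> (I +>\<^bsub>A\<^esub> x) = I +>\<^bsub>A\<^esub> (s c \<otimes>\<^bsub>A\<^esub> x)" if x: "x \<in> carrier A" for c x
  proof -
    have "I +>\<^bsub>A\<^esub> (c \<odot>\<^bsub>A\<^esub> y) = I +>\<^bsub>A\<^esub> (s c \<otimes>\<^bsub>A\<^esub> x)" if y: "y \<in> I +>\<^bsub>A\<^esub> x" for y
    proof -
      have yc: "y \<in> carrier A" using y x a_r_coset_subset_G[OF a_subset] by blast
      have "I +>\<^bsub>A\<^esub> y = I +>\<^bsub>A\<^esub> x"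
        using a_repr_independence[OF y x a_subgroup] by simp
      then show ?thesis
        using rcoset_mult_add[of "s c" y] rcoset_mult_add[of "s c" x] s x yc by simp
    qed
    moreover have "x \<in> I +>\<^bsub>A\<^esub> x" by (rule a_rcos_self[OF x])
    ultimately show ?thesis by auto
  qed
  show "(+>\<^bsub>A\<^esub>) I \<in> alg_hom A (alg_quot A I)"
    unfolding alg_hom_def using hom' s smult by auto
  show "has_scalars (alg_quot A I) (\<lambda>c. I +>\<^bsub>A\<^esub> s c)"
    unfolding has_scalars_def
  proof (intro conjI allI ballI ring')
    show "I +>\<^bsub>A\<^esub> s c \<in> carrier (alg_quot A I)" for c
      using surj s by blast
    fix c C assume "C \<in> carrier (alg_quot A I)"
    then obtain x where x: "x \<in> carrier A" "C = I +>\<^bsub>A\<^esub> x" using surj by blast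
    show "c \<odot>\<^bsub>alg_quot A I\<^esub> C = (I +>\<^bsub>A\<^esub> s c) \<otimes>\<^bsub>alg_quot A I\<^esub> C"
      unfolding x(2) smult[OF x(1)] using Ring.ring_hom_mult[OF hom' s(1) x(1)] by simp
  qed
qed

text \<open>
  Two quotients \<open>C\<close> of \<open>A\<close> and \<open>D\<close> of \<open>B\<close> are isomorphic as soon as maps between
  \<open>A\<close> and \<open>B\<close> descend to mutually inverse maps between them.  That \<open>F\<close> is a
  homomorphism makes the induced bijection an isomorphism.
\<close>
lemma alg_iso_of_mutually_inverse:
  assumes "ring A"
    and \<pi>: "\<pi> \<in> alg_hom A C" "\<pi> ` carrier A = carrier C"
    and \<tau>: "\<tau> \<in> alg_hom B D" "\<tau> ` carrier B = carrier D"
    and F: "F \<in> alg_hom A B" and G: "\<And>y. y \<in> carrier B \<Longrightarrow> G y \<in> carrier A"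
    and smult: "\<And>c x. x \<in> carrier A \<Longrightarrow> c \<odot>\<^bsub>A\<^esub> x \<in> carrier A"
    and 1: "\<And>x y. x \<in> carrier A \<Longrightarrow> y \<in> carrier A \<Longrightarrow> \<pi> x = \<pi> y \<Longrightarrow> \<tau> (F x) = \<tau> (F y)"
    and 2: "\<And>x y. x \<in> carrier B \<Longrightarrow> y \<in> carrier B \<Longrightarrow> \<tau> x = \<tau> y \<Longrightarrow> \<pi> (G x) = \<pi> (G y)"
    and 3: "\<And>x. x \<in> carrier A \<Longrightarrow> \<pi> (G (F x)) = \<pi> x"
    and 4: "\<And>y. y \<in> carrier B \<Longrightarrow> \<tau> (F (G y)) = \<tau> y"
  shows "\<exists>\<phi> \<in> alg_iso C D. \<forall>x \<in> carrier A. \<phi> (\<pi> x) = \<tau> (F x)"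
proof -
  interpret A: ring A by (rule assms(1))
  define \<phi> where "\<phi> c = \<tau> (F (inv_into (carrier A) \<pi> c))" for c
  have \<phi>: "\<phi> (\<pi> x) = \<tau> (F x)" if "x \<in> carrier A" for x
    unfolding \<phi>_def using that by (intro 1) (auto intro: inv_into_into f_inv_into_f)
  have F': "F x \<in> carrier B" if "x \<in> carrier A" for x
    using F that by (auto simp: alg_hom_def Ring.ring_hom_def)
  have rep: "\<exists>x \<in> carrier A. c = \<pi> x" if "c \<in> carrier C" for c using that \<pi>(2) by blast
  have "bij_betw \<phi> (carrier C) (carrier D)"
  proof (rule bij_betw_imageI)
    show "inj_on \<phi> (carrier C)"
    proof (rule inj_onI)
      fix c c' assume "c \<in> carrier C" "c' \<in> carrier C" and eq: "\<phi> c = \<phi> c'"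
      then obtain x y where xy: "x \<in> carrier A" "c = \<pi> x" "y \<in> carrier A" "c' = \<pi> y"
        using rep by metis
      then have "\<pi> (G (F x)) = \<pi> (G (F y))" using eq \<phi> F' by (intro 2) auto
      then show "c = c'" using 3 xy by simp
    qed
    show "\<phi> ` carrier C = carrier D"
    proof
      show "\<phi> ` carrier C \<subseteq> carrier D" using rep \<phi> F' \<tau>(2) by (metis image_subsetI imageI)
      show "carrier D \<subseteq> \<phi> ` carrier C"
      proof
        fix d assume "d \<in> carrier D"
        then obtain y where y: "y \<in> carrier B" "d = \<tau> y" using \<tau>(2) by blast
        then have "d = \<phi> (\<pi> (G y))" using 4 G \<phi> by simp
        then show "d \<in> \<phi> ` carrier C" using y G \<pi>(2) by blast
      qed
    qed
  qed
  moreover have "\<phi> \<in> alg_hom C D"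
    unfolding alg_hom_def
  proof (intro CollectI conjI allI ballI Ring.ring_hom_memI)
    have h: "\<pi> \<in> Ring.ring_hom A C" "\<tau> \<in> Ring.ring_hom B D" "F \<in> Ring.ring_hom A B"
      using \<pi>(1) \<tau>(1) F by (auto simp: alg_hom_def)
    note hom = Ring.ring_hom_memE[OF h(1)] Ring.ring_hom_memE[OF h(2)] Ring.ring_hom_memE[OF h(3)]
    show "\<phi> c \<in> carrier D" if "c \<in> carrier C" for c
      using that rep \<phi> F' \<tau>(2) by (metis imageI)
    show "\<phi> \<one>\<^bsub>C\<^esub> = \<one>\<^bsub>D\<^esub>" using \<phi>[OF A.one_closed] hom by simp
    fix c c' assume "c \<in> carrier C" "c' \<in> carrier C"
    then obtain x y where xy: "x \<in> carrier A" "c = \<pi> x" "y \<in> carrier A" "c' = \<pi> y"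
      using rep by metis
    then show "\<phi> (c \<otimes>\<^bsub>C\<^esub> c') = \<phi> c \<otimes>\<^bsub>D\<^esub> \<phi> c'" "\<phi> (c \<oplus>\<^bsub>C\<^esub> c') = \<phi> c \<oplus>\<^bsub>D\<^esub> \<phi> c'"
      using \<phi>[of "x \<otimes>\<^bsub>A\<^esub> y"] \<phi>[of "x \<oplus>\<^bsub>A\<^esub> y"] by (simp_all add: hom \<phi>)
  next
    note hom = \<pi>(1)[unfolded alg_hom_def] \<tau>(1)[unfolded alg_hom_def] F[unfolded alg_hom_def]
    fix k c assume "c \<in> carrier C"
    then obtain x where x: "x \<in> carrier A" "c = \<pi> x" using rep by blast
    then show "\<phi> (k \<odot>\<^bsub>C\<^esub> c) = k \<odot>\<^bsub>D\<^esub> \<phi> c"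
      using \<phi>[OF smult[OF x(1), of k]] hom by (simp add: \<phi>[OF x(1)] F')
  qed
  ultimately show ?thesis
    using \<phi> by (auto simp: alg_iso_def)
qed

text \<open>The underlying rings agree up to the record extension by the scalar multiplication.\<close>
lemma ideal_alg_quotI:
  assumes "has_scalars A s" "ideal I A" "ideal J (A Quot I)"
  shows "ideal J (alg_quot A I)"
proof -
  interpret J: ideal J "A Quot I" by (rule assms(3))
  interpret Q: ring "alg_quot A I" by (rule alg_quot_hom(3)[OF assms(1,2)])
  show ?thesis
  proof (rule idealI)
    show "subgroup J (add_monoid (alg_quot A I))"
      using J.a_subgroup by (auto simp: subgroup_def m_inv_def)
  qed (auto intro: J.I_l_closed J.I_r_closed Q.ring_axioms)
qed

lemma free_alg_minus:
  assumes "x \<in> carrier (free_alg G)" "y \<in> carrier (free_alg G)"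
  shows "x \<ominus>\<^bsub>free_alg G\<^esub> y = x - y"
proof -
  interpret ring "free_alg G" by (rule ring_free_alg)
  have "\<ominus>\<^bsub>free_alg G\<^esub> y = 0 - y"
    by (rule minus_equality) (use assms free_alg_closed(3)[OF free_alg_closed(5)] in auto)
  then show ?thesis by (simp add: a_minus_def)
qed

locale free_alg_map = R: ring R + F: ring "free_alg G" for R (structure) and G :: "'g set" +
  fixes c :: "'g free \<Rightarrow> 'a"
  assumes c_hom: "c \<in> Ring.ring_hom (free_alg G) R"
begin

lemma c_closed [simp]: "x \<in> carrier (free_alg G) \<Longrightarrow> c x \<in> carrier R"
  using Ring.ring_hom_closed[OF c_hom] .

lemma c_mult: "x \<in> carrier (free_alg G) \<Longrightarrow> y \<in> carrier (free_alg G) \<Longrightarrow> c (x * y) = c x \<otimes> c y"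
  using Ring.ring_hom_mult[OF c_hom] by simp

lemma c_add: "x \<in> carrier (free_alg G) \<Longrightarrow> y \<in> carrier (free_alg G) \<Longrightarrow> c (x + y) = c x \<oplus> c y"
  using Ring.ring_hom_add[OF c_hom] by simp

lemma c_one: "c 1 = \<one>"
  using Ring.ring_hom_one[OF c_hom] by simp

lemma c_zero: "c 0 = \<zero>"
  using Ring.ring_hom_zero[OF c_hom F.ring_axioms R.ring_axioms] by simp

lemma c_diff: "x \<in> carrier (free_alg G) \<Longrightarrow> y \<in> carrier (free_alg G) \<Longrightarrow> c (x - y) = c x \<ominus> c y"
proof -
  assume xy: "x \<in> carrier (free_alg G)" "y \<in> carrier (free_alg G)"
  then have "c (x - y) \<oplus> c y = c x"
    using c_add[of "x - y" y] by (simp add: free_alg_closed)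
  moreover have "c (x - y) \<in> carrier R" "c x \<in> carrier R" "c y \<in> carrier R"
    using xy by (simp_all add: free_alg_closed)
  ultimately show ?thesis by (metis R.add.inv_solve_right a_minus_def)
qed

lemmas c_simps = c_mult c_add c_one c_zero c_diff

lemma kernel_ideal: "ideal {p \<in> carrier (free_alg G). c p = \<zero>} (free_alg G)"
  by (rule free_alg_idealI) (auto simp: c_simps free_alg_closed)

lemma factor:
  assumes rel: "\<And>l r. (l, r) \<in> Rel \<Longrightarrow>
      l \<in> carrier (free_alg G) \<and> r \<in> carrier (free_alg G) \<and> c l = c r"
  shows "rel_ideal G Rel \<subseteq> {p \<in> carrier (free_alg G). c p = \<zero>}"
  using rel by (intro rel_ideal_minimal[OF kernel_ideal]) (auto simp: c_diff free_alg_closed R.minus_eq R.r_neg)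

end

locale presentation =
  fixes G :: "'g set" and Rel
  assumes rels_closed: "{l - r | l r. (l, r) \<in> Rel} \<subseteq> carrier (free_alg G)"
begin

lemma rel_ideal: "ideal (rel_ideal G Rel) (free_alg G)"
  unfolding rel_ideal_def by (rule ring.genideal_ideal[OF ring_free_alg rels_closed])

lemma class_hom: "presented_class G Rel \<in> alg_hom (free_alg G) (presented_alg G Rel)"
  and class_surj: "presented_class G Rel ` carrier (free_alg G) = carrier (presented_alg G Rel)"
  and ring_presented: "ring (presented_alg G Rel)"
  and has_scalars_presented:
    "has_scalars (presented_alg G Rel) (\<lambda>c. presented_class G Rel (scal c))"
  using alg_quot_hom[OF has_scalars_free_alg rel_ideal]
  by (simp_all add: presented_alg_def presented_class_def [abs_def])

lemma class_eq_iff: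
  assumes "x \<in> carrier (free_alg G)" "y \<in> carrier (free_alg G)"
  shows "presented_class G Rel x = presented_class G Rel y \<longleftrightarrow> x - y \<in> rel_ideal G Rel"
  unfolding presented_class_def coset_eq_iff[OF rel_ideal assms] free_alg_minus[OF assms] ..

lemma class_rel:
  assumes "(l, r) \<in> Rel" "l \<in> carrier (free_alg G)" "r \<in> carrier (free_alg G)"
  shows "presented_class G Rel l = presented_class G Rel r"
proof -
  have "l - r \<in> rel_ideal G Rel"
    unfolding rel_ideal_def using ring.genideal_self[OF ring_free_alg rels_closed] assms(1) by blast
  then show ?thesis using class_eq_iff assms by blast
qed

lemma free_alg_map: "free_alg_map (presented_alg G Rel) G (presented_class G Rel)"
  using class_hom ring_presented
  by (auto simp: free_alg_map_def free_alg_map_axioms_def ring_free_alg alg_hom_def)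

end

text \<open>
  For commutative targets this tests whether an element survives in a presented algebra: it does
  when some evaluation maps all relations, but not the element, to multiples of \<open>D\<close>.
\<close>
lemma eval_dvd_ideal:
  fixes D :: "'b :: comm_ring_1"
  assumes "scalar_hom s"
  shows "ideal {p \<in> carrier (free_alg G). D dvd eval s f p} (free_alg G)"
proof -
  interpret scalar_hom s by (rule assms)
  show ?thesis
    by (rule free_alg_idealI) (auto simp: eval_simps free_alg_closed)
qed

section \<open>Square-zero elements of semisimple algebras\<close>

text \<open>
  A semisimple algebra has no nilpotent ideals.  Write \<open>1\<close> as a sum of elements \<open>e\<^sub>L\<close> of
  minimal left ideals \<open>L\<close>.  If \<open>z e\<^sub>L \<noteq> 0\<close>, then by minimality \<open>L = A z e\<^sub>L\<close> contains
  \<open>e\<^sub>L = x z e\<^sub>L\<close>, whence \<open>z e\<^sub>L = z x z e\<^sub>L = 0\<close>.  So \<open>z\<close> annihilates every \<open>e\<^sub>L\<close> and is \<open>0\<close>.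
\<close>
lemma semisimple_no_square_zero:
  assumes "ring A" "semisimple_alg A" and z: "z \<in> carrier A"
    and zaz: "\<And>x. x \<in> carrier A \<Longrightarrow> z \<otimes>\<^bsub>A\<^esub> x \<otimes>\<^bsub>A\<^esub> z = \<zero>\<^bsub>A\<^esub>"
  shows "z = \<zero>\<^bsub>A\<^esub>"
proof -
  interpret ring A by (rule assms(1))
  from assms(2) obtain S where S: "finite S" "\<forall>L \<in> S. minimal_left_ideal L A"
    and dec: "\<forall>x \<in> carrier A. \<exists>!f. f \<in> (\<Pi>\<^sub>E L\<in>S. L) \<and> x = (\<Oplus>\<^bsub>A\<^esub>L\<in>S. f L)"
    unfolding semisimple_alg_def by blast
  from dec obtain f where f: "f \<in> (\<Pi>\<^sub>E L\<in>S. L)" "\<one>\<^bsub>A\<^esub> = (\<Oplus>\<^bsub>A\<^esub>L\<in>S. f L)"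
    by (meson one_closed)
  have sub: "L \<subseteq> carrier A" if "L \<in> S" for L
    using S(2) that by (auto simp: minimal_left_ideal_def left_ideal_def additive_subgroup_def
        subgroup_def)
  have fL: "f L \<in> L" "f L \<in> carrier A" if "L \<in> S" for L
    using f(1) sub that by (auto simp: PiE_iff)
  have "z \<otimes>\<^bsub>A\<^esub> f L = \<zero>\<^bsub>A\<^esub>" if L: "L \<in> S" for L
  proof (rule ccontr)
    assume nz: "z \<otimes>\<^bsub>A\<^esub> f L \<noteq> \<zero>\<^bsub>A\<^esub>"
    note [simp] = z fL(2)[OF L]
    have left: "left_ideal L A" using S(2) L by (simp add: minimal_left_ideal_def)
    define L' where "L' = (\<lambda>x. x \<otimes>\<^bsub>A\<^esub> (z \<otimes>\<^bsub>A\<^esub> f L)) ` carrier A"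
    have "L' \<subseteq> L"
      using left fL(1)[OF L] by (auto simp: L'_def left_ideal_def)
    moreover have "left_ideal L' A"
      unfolding left_ideal_def
    proof (intro conjI ballI)
      show "additive_subgroup L' A"
      proof (rule additive_subgroupI, rule add.subgroupI)
        show "L' \<subseteq> carrier A" "L' \<noteq> {}" by (auto simp: L'_def)
        show "\<ominus>\<^bsub>A\<^esub> x \<in> L'" if "x \<in> L'" for x
          using that by (auto simp: L'_def l_minus[symmetric])
        show "x \<oplus>\<^bsub>A\<^esub> y \<in> L'" if "x \<in> L'" "y \<in> L'" for x y
          using that by (auto simp: L'_def l_distr[symmetric])
      qed
      show "x \<otimes>\<^bsub>A\<^esub> y \<in> L'" if "x \<in> carrier A" "y \<in> L'" for x y
        using that by (auto simp: L'_def m_assoc[of x _ "z \<otimes>\<^bsub>A\<^esub> f L", symmetric])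
    qed
    moreover have "z \<otimes>\<^bsub>A\<^esub> f L \<in> L'"
      unfolding L'_def by (rule image_eqI[of _ _ "\<one>\<^bsub>A\<^esub>"]) auto
    ultimately have "L' = L" using S(2) L nz by (auto simp: minimal_left_ideal_def)
    then obtain x where x: "x \<in> carrier A" "f L = x \<otimes>\<^bsub>A\<^esub> (z \<otimes>\<^bsub>A\<^esub> f L)"
      using fL(1)[OF L] by (auto simp: L'_def)
    have "z \<otimes>\<^bsub>A\<^esub> f L = z \<otimes>\<^bsub>A\<^esub> x \<otimes>\<^bsub>A\<^esub> z \<otimes>\<^bsub>A\<^esub> f L"
      using x by (simp add: m_assoc)
    then show False using zaz[OF x(1)] nz by simp
  qed
  then have "(\<Oplus>\<^bsub>A\<^esub>L\<in>S. z \<otimes>\<^bsub>A\<^esub> f L) = \<zero>\<^bsub>A\<^esub>"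
    by (simp add: add.finprod_one_eqI)
  moreover have "z \<otimes>\<^bsub>A\<^esub> (\<Oplus>\<^bsub>A\<^esub>L\<in>S. f L) = (\<Oplus>\<^bsub>A\<^esub>L\<in>S. z \<otimes>\<^bsub>A\<^esub> f L)"
    by (rule finsum_rdistr) (use S z fL in auto)
  ultimately show ?thesis using f(2) z by (metis r_one)
qed

section \<open>The sign element in images of the Hecke algebra\<close>

text \<open>
  With \<open>P = 1 - X\<^sub>1\<close> this is \<open>P T\<^sub>1\<^sup>-\<^sup>1 P (T\<^sub>1 - q)\<close>, a multiple of the central idempotent of the
  sign representation when \<open>q\<^sup>2 \<noteq> -1\<close>.  Unlike the idempotent it also exists for \<open>q\<^sup>2 = -1\<close>.  In terms of the rook monoid algebra it is
  \<open>q\<^sup>-\<^sup>1 P\<^sub>2 (T\<^sub>1 - q)\<close>, so its vanishing is the one relation that is to be imposed.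
\<close>
definition sign_elt :: "complex \<Rightarrow> hecke_gen free" where
  "sign_elt q = (1 - hX) * (hT 1 - scal (q - inverse q)) * (1 - hX) * (hT 1 - scal q)"

text \<open>The sign representation, as a character of the free algebra.\<close>
definition sign_char :: "complex \<Rightarrow> hecke_gen free \<Rightarrow> complex" where
  "sign_char q = eval (\<lambda>c. c) (case_hecke_gen 0 (\<lambda>_. - inverse q))"

lemma gens_closed [simp]:
  "hX \<in> carrier (free_alg (hecke_gens k))"
  "1 \<le> i \<Longrightarrow> i < k \<Longrightarrow> hT i \<in> carrier (free_alg (hecke_gens k))"
  "1 \<le> i \<Longrightarrow> i < k \<Longrightarrow> rT i \<in> carrier (free_alg (rook_gens k))"
  "1 \<le> i \<Longrightarrow> i \<le> k \<Longrightarrow> rP i \<in> carrier (free_alg (rook_gens k))"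
  by (auto intro!: free_alg_closed simp: hecke_gens_def rook_gens_def)

lemma sign_elt_closed: "2 \<le> k \<Longrightarrow> sign_elt q \<in> carrier (free_alg (hecke_gens k))"
  unfolding sign_elt_def by (intro free_alg_closed gens_closed) auto

interpretation cscal: scalar_hom "\<lambda>c. c :: complex"
  by (rule scalar_hom_id)

lemmas sign_char_simps = cscal.eval_simps[where f = "case_hecke_gen 0 (\<lambda>_. - inverse q)" for q,
    folded sign_char_def]

lemma sign_char_sign_elt:
  assumes "q \<noteq> 0"
  shows "sign_char q (sign_elt q) = q\<^sup>2 + 1"
proof -
  have "sign_char q (sign_elt q) = (- inverse q - (q - inverse q)) * (- inverse q - q)"
    by (simp add: sign_elt_def sign_char_simps)
  also have "\<dots> = q\<^sup>2 + 1" using assms by (simp add: field_simps power2_eq_square)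
  finally show ?thesis .
qed

text \<open>
  A ring that is an image of the Hecke algebra.  It is used for \<open>H\<^sub>2\<close>, for \<open>H\<^sub>k\<close> and for the
  quotient of \<open>H\<^sub>k\<close> by the ideal \<open>I\<close>.
\<close>
locale hecke_map = free_alg_map R "hecke_gens k" c for R (structure) and k c +
  fixes q :: complex
  assumes q: "q \<noteq> 0" and k: "2 \<le> k"
    and surj: "c ` carrier (free_alg (hecke_gens k)) = carrier R"
    and rel: "\<And>l r. (l, r) \<in> hecke_rels k 0 1 q \<Longrightarrow> c l = c r"
begin

abbreviation "X \<equiv> c hX"
abbreviation "T i \<equiv> c (hT i)"
abbreviation "a \<equiv> c (scal q)"
abbreviation "b \<equiv> c (scal (inverse q))"
abbreviation "Z \<equiv> c (sign_elt q)"

text \<open>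
  This is \<open>P\<^sub>1 T\<^sub>1\<^sup>-\<^sup>1 P\<^sub>1\<close> with \<open>P\<^sub>1 = 1 - X\<^sub>1\<close>, so it corresponds to \<open>q\<^sup>-\<^sup>1 P\<^sub>2\<close> in the rook monoid algebra.
\<close>
definition "Y = (\<one> \<ominus> X) \<otimes> (T 1 \<ominus> (a \<ominus> b)) \<otimes> (\<one> \<ominus> X)"

lemma closed [simp]: "X \<in> carrier R" "1 \<le> i \<Longrightarrow> i < k \<Longrightarrow> T i \<in> carrier R"
  "c (scal e) \<in> carrier R" "Z \<in> carrier R"
  using k by (simp_all add: free_alg_closed sign_elt_closed)

lemma T1_closed [simp]: "T (Suc 0) \<in> carrier R"
  using closed(2)[of 1] k by simp

lemma c_scal_central: "x \<in> carrier R \<Longrightarrow> x \<otimes> c (scal e) = c (scal e) \<otimes> x"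
proof -
  assume "x \<in> carrier R"
  then obtain p where p: "p \<in> carrier (free_alg (hecke_gens k))" "x = c p" using surj by blast
  then have "c (p * scal e) = c (scal e * p)" by (simp only: scal_central)
  then show ?thesis using p by (simp add: c_mult free_alg_closed)
qed

lemma ab: "a \<otimes> b = \<one>"
  using q by (simp add: scal_simps c_simps free_alg_closed flip: c_mult)

lemma c_scal_diff: "c (scal (q - inverse q)) = a \<ominus> b"
  by (simp add: free_alg_closed scal_simps flip: c_diff)

lemma XX: "X \<otimes> X = X"
proof -
  have "c ((hX - scal 0) * (hX - scal 1)) = c 0"
    by (rule rel) (simp add: hecke_rels_def)
  moreover have "c ((hX - scal 0) * (hX - scal 1)) = X \<otimes> (X \<ominus> \<one>)"
    by (simp add: scal_simps c_simps free_alg_closed)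
  ultimately have "X \<otimes> (X \<ominus> \<one>) = \<zero>" by (simp add: c_zero)
  moreover have "X \<otimes> (X \<ominus> \<one>) = X \<otimes> X \<ominus> X" by (simp add: R.minus_eq R.r_distr R.r_minus)
  ultimately show ?thesis by (simp add: R.minus_eq_zero_iff)
qed

lemma TT: "1 \<le> i \<Longrightarrow> i < k \<Longrightarrow> T i \<otimes> T i = (a \<ominus> b) \<otimes> T i \<oplus> \<one>"
proof -
  assume i: "1 \<le> i" "i < k"
  have "c (hT i * hT i) = c (scal (q - inverse q) * hT i + 1)"
    using i by (intro rel) (auto simp: hecke_rels_def)
  then show ?thesis using i by (simp add: c_simps free_alg_closed c_scal_diff)
qed

lemma braid: "1 \<le> i \<Longrightarrow> Suc i < k \<Longrightarrow> T i \<otimes> T (Suc i) \<otimes> T i = T (Suc i) \<otimes> T i \<otimes> T (Suc i)"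
proof -
  assume i: "1 \<le> i" "Suc i < k"
  have "c (hT i * hT (i+1) * hT i) = c (hT (i+1) * hT i * hT (i+1))"
    using i by (intro rel) (fastforce simp: hecke_rels_def)
  then show ?thesis using i by (simp add: c_simps free_alg_closed)
qed

lemma far: "1 \<le> i \<Longrightarrow> i < k \<Longrightarrow> 1 \<le> j \<Longrightarrow> j < k \<Longrightarrow> Suc i < j \<Longrightarrow> T i \<otimes> T j = T j \<otimes> T i"
proof -
  assume i: "1 \<le> i" "i < k" "1 \<le> j" "j < k" "Suc i < j"
  have "c (hT i * hT j) = c (hT j * hT i)"
  proof (rule rel)
    have "i \<in> {1..k - 1}" "j \<in> {1..k - 1}" using i by auto
    then show "(hT i * hT j, hT j * hT i) \<in> hecke_rels k 0 1 q"
      unfolding hecke_rels_def using i(5) by (simp only: Suc_eq_plus1) blast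
  qed
  then show ?thesis using i by (simp add: c_simps free_alg_closed)
qed

lemma X_comm: "2 \<le> j \<Longrightarrow> j < k \<Longrightarrow> X \<otimes> T j = T j \<otimes> X"
proof -
  assume j: "2 \<le> j" "j < k"
  have "c (hX * hT j) = c (hT j * hX)"
    using j by (intro rel) (fastforce simp: hecke_rels_def)
  then show ?thesis using j by (simp add: c_simps free_alg_closed)
qed

lemma XTXT: "X \<otimes> T 1 \<otimes> X \<otimes> T 1 = T 1 \<otimes> X \<otimes> T 1 \<otimes> X"
proof -
  have "c (hX * hT 1 * hX * hT 1) = c (hT 1 * hX * hT 1 * hX)"
    using k by (intro rel) (simp add: hecke_rels_def)
  then show ?thesis using k by (simp add: c_simps free_alg_closed)
qed

lemma d_central: "x \<in> carrier R \<Longrightarrow> x \<otimes> (a \<ominus> b) = (a \<ominus> b) \<otimes> x"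
  using c_scal_central[of x "q - inverse q"] by (simp add: c_scal_diff)

lemma Z_eq: "Z = Y \<otimes> (T 1 \<ominus> a)"
  using k by (simp add: Y_def sign_elt_def c_simps free_alg_closed scal_simps c_scal_diff)

lemma Y_closed [simp]: "Y \<in> carrier R"
  by (simp add: Y_def)

lemma Y_comm: "Y \<otimes> T 1 = T 1 \<otimes> Y"
proof -
  have "Y \<otimes> T 1 \<ominus> T 1 \<otimes> Y = X \<otimes> T 1 \<otimes> X \<otimes> T 1 \<ominus> T 1 \<otimes> X \<otimes> T 1 \<otimes> X"
    by (rule R.commutator[where d = "a \<ominus> b"]) (use d_central XX TT k in \<open>auto simp: Y_def\<close>)
  also have "\<dots> = \<zero>" using XTXT by (simp add: R.minus_eq R.r_neg)
  finally show ?thesis by (simp add: R.minus_eq_zero_iff)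
qed

lemma X_kills: "X \<otimes> (\<one> \<ominus> X) = \<zero>" "(\<one> \<ominus> X) \<otimes> X = \<zero>"
  by (simp_all add: R.minus_eq R.r_distr R.l_distr R.r_minus R.l_minus XX R.r_neg)

lemma XY: "X \<otimes> Y = \<zero>" and YX: "Y \<otimes> X = \<zero>"
  by (simp_all add: Y_def X_kills R.m_assoc) (simp add: X_kills R.m_assoc[symmetric])

lemma Z_eq': "Z = Y \<otimes> T 1 \<ominus> a \<otimes> Y" "Z = (T 1 \<ominus> a) \<otimes> Y"
proof -
  have carr: "T 1 \<in> carrier R" "a \<in> carrier R" "Y \<in> carrier R" by simp_all
  have "Z = Y \<otimes> T 1 \<ominus> Y \<otimes> a"
    unfolding Z_eq using carr by algebra
  then show 1: "Z = Y \<otimes> T 1 \<ominus> a \<otimes> Y"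
    by (simp only: c_scal_central[OF Y_closed])
  show "Z = (T 1 \<ominus> a) \<otimes> Y"
    unfolding 1 Y_comm using carr by algebra
qed

lemma XZ: "X \<otimes> Z = \<zero>" and ZX: "Z \<otimes> X = \<zero>"
proof -
  show "X \<otimes> Z = \<zero>"
    unfolding Z_eq by (simp add: XY R.m_assoc[symmetric])
  show "Z \<otimes> X = \<zero>"
    unfolding Z_eq'(2) by (simp add: YX R.m_assoc)
qed

lemma quadratic_factor: "T 1 \<otimes> (T 1 \<ominus> a) = c (scal (- inverse q)) \<otimes> (T 1 \<ominus> a)"
proof -
  have [simp]: "T 1 \<in> carrier R" by simp
  have m: "c (scal (- inverse q)) = \<ominus> b"
  proof -
    have "c (scal 0 - scal (inverse q)) = \<ominus> b"
      by (simp add: c_diff free_alg_closed) (simp add: scal_simps c_zero R.minus_eq)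
    then show ?thesis unfolding scal_simps(5) by simp
  qed
  have ba: "b \<otimes> a = \<one>" using ab c_scal_central[of b q] by simp
  have carr: "T 1 \<in> carrier R" "a \<in> carrier R" "b \<in> carrier R" by simp_all
  have "T 1 \<otimes> (T 1 \<ominus> a) = T 1 \<otimes> T 1 \<ominus> T 1 \<otimes> a" using carr by algebra
  also have "\<dots> = (a \<ominus> b) \<otimes> T 1 \<oplus> b \<otimes> a \<ominus> a \<otimes> T 1"
    using TT[of 1] c_scal_central[of "T 1" q] ba k by simp
  also have "\<dots> = (\<ominus> b) \<otimes> (T 1 \<ominus> a)" using carr by algebra
  finally show ?thesis unfolding m .
qed

lemma TZ: "T 1 \<otimes> Z = c (scal (- inverse q)) \<otimes> Z" and ZT: "Z \<otimes> T 1 = c (scal (- inverse q)) \<otimes> Z"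
proof -
  let ?m = "c (scal (- inverse q))"
  have [simp]: "T 1 \<in> carrier R" by simp
  have "T 1 \<otimes> Z = T 1 \<otimes> (T 1 \<ominus> a) \<otimes> Y"
    unfolding Z_eq'(2) by (simp only: R.m_assoc \<open>T 1 \<in> carrier R\<close> R.minus_closed closed Y_closed)
  then show 1: "T 1 \<otimes> Z = ?m \<otimes> Z"
    unfolding quadratic_factor Z_eq'(2) by (simp add: R.m_assoc)
  have "Z \<otimes> T 1 = (T 1 \<ominus> a) \<otimes> (Y \<otimes> T 1)"
    unfolding Z_eq'(2) by (simp add: R.m_assoc)
  also have "\<dots> = ((T 1 \<ominus> a) \<otimes> T 1) \<otimes> Y"
    unfolding Y_comm by (simp add: R.m_assoc)
  also have "(T 1 \<ominus> a) \<otimes> T 1 = T 1 \<otimes> (T 1 \<ominus> a)"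
    using c_scal_central[of "T 1" q] by (simp add: R.minus_eq R.r_distr R.l_distr R.r_minus R.l_minus)
  finally show "Z \<otimes> T 1 = ?m \<otimes> Z"
    unfolding quadratic_factor Z_eq'(2) by (simp add: R.m_assoc)
qed

text \<open>
  In the quotient by \<open>I\<close>, this is the relation \<open>P\<^sub>2 T\<^sub>1 = q P\<^sub>2\<close> that starts the tower.
\<close>
lemma Z_zero_iff: "Z = \<zero> \<longleftrightarrow> Y \<otimes> T 1 = a \<otimes> Y"
  unfolding Z_eq'(1) by (rule R.minus_eq_zero_iff) simp_all

text \<open>
  Hence the multiples of the sign element form a two-sided ideal of \<open>H\<^sub>2\<close>, on which \<open>H\<^sub>2\<close> acts
  by the sign character from both sides.  It suffices to check generators.
\<close>
lemma Z_absorbs: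
  assumes "p \<in> carrier (free_alg (hecke_gens 2))"
  shows "c p \<otimes> Z = c (scal (sign_char q p)) \<otimes> Z" "Z \<otimes> c p = c (scal (sign_char q p)) \<otimes> Z"
proof -
  have sub: "x \<in> carrier (free_alg (hecke_gens k))" if "x \<in> carrier (free_alg (hecke_gens 2))" for x
    using that free_alg_mono[of "hecke_gens 2" "hecke_gens k"] k by (auto simp: hecke_gens_def)
  have "c p \<otimes> Z = c (scal (sign_char q p)) \<otimes> Z \<and> Z \<otimes> c p = c (scal (sign_char q p)) \<otimes> Z"
    using assms
  proof (induction rule: free_alg_induct)
    case (scal e)
    then show ?case using c_scal_central[of Z e] by (simp add: sign_char_simps)
  next
    case (gen g)
    have "g = HX \<or> g = HT 1" using gen by (auto simp: hecke_gens_def)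
    then show ?case
      using XZ ZX TZ ZT by (auto simp: sign_char_simps scal_simps c_zero)
  next
    case (add p r)
    then show ?case
      using sub[OF add.hyps(1)] sub[OF add.hyps(2)]
      by (simp add: sign_char_simps c_add R.l_distr R.r_distr free_alg_closed flip: scal_simps(2))
  next
    case (mult p r)
    note pr = sub[OF mult.hyps(1)] sub[OF mult.hyps(2)]
    let ?p = "c (scal (sign_char q p))" and ?r = "c (scal (sign_char q r))"
    have e: "c (scal (sign_char q (p * r))) = ?p \<otimes> ?r"
      by (simp add: sign_char_simps c_mult free_alg_closed flip: scal_simps(1))
    have com: "?p \<otimes> ?r = ?r \<otimes> ?p" by (rule c_scal_central) simp
    have "c (p * r) \<otimes> Z = c p \<otimes> (?r \<otimes> Z)"
      using pr mult.IH by (simp add: c_mult R.m_assoc)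
    also have "\<dots> = ?r \<otimes> (c p \<otimes> Z)"
      using pr by (simp add: c_scal_central[of "c p"] flip: R.m_assoc)
    also have "\<dots> = c (scal (sign_char q (p * r))) \<otimes> Z"
      using mult.IH unfolding e com by (simp add: R.m_assoc)
    finally have 1: "c (p * r) \<otimes> Z = c (scal (sign_char q (p * r))) \<otimes> Z" .
    have "Z \<otimes> c (p * r) = ?p \<otimes> (Z \<otimes> c r)"
      using pr mult.IH by (simp add: c_mult flip: R.m_assoc) (simp add: R.m_assoc)
    also have "\<dots> = c (scal (sign_char q (p * r))) \<otimes> Z"
      using mult.IH unfolding e by (simp add: R.m_assoc)
    finally show ?case using 1 by simp
  qed
  then show "c p \<otimes> Z = c (scal (sign_char q p)) \<otimes> Z" "Z \<otimes> c p = c (scal (sign_char q p)) \<otimes> Z"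
    by auto
qed

end

section \<open>The sign element and semisimplicity of H2\<close>

lemma hecke_rels_carrier:
  assumes "(l, r) \<in> hecke_rels k u1 u2 q"
  shows "l \<in> carrier (free_alg (hecke_gens k)) \<and> r \<in> carrier (free_alg (hecke_gens k))"
  using assms unfolding hecke_rels_def
  by (auto split: if_splits simp: hecke_gens_def intro!: free_alg_closed)

lemma rook_rels_carrier:
  assumes "(l, r) \<in> rook_rels k q"
  shows "l \<in> carrier (free_alg (rook_gens k)) \<and> r \<in> carrier (free_alg (rook_gens k))"
  using assms unfolding rook_rels_def
  by (auto simp: rook_gens_def intro!: free_alg_closed)

lemma hecke_presentation: "presentation (hecke_gens k) (hecke_rels k u1 u2 q)"
  by unfold_locales (rule hecke_rels_closed)

lemma rook_presentation: "presentation (rook_gens k) (rook_rels k q)"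
  by unfold_locales (rule rook_rels_closed)

lemma hecke_map_class:
  assumes "q \<noteq> 0" "2 \<le> k"
  shows "hecke_map (hecke_alg k 0 1 q) k (hecke_class k 0 1 q) q"
proof -
  interpret presentation "hecke_gens k" "hecke_rels k 0 1 q" by (rule hecke_presentation)
  show ?thesis
    using assms free_alg_map class_surj class_rel hecke_rels_carrier[of _ _ k 0 1 q]
    unfolding hecke_map_def hecke_map_axioms_def hecke_alg_def hecke_class_def by blast
qed

lemma sign_char_rel_ideal:
  assumes "q \<noteq> 0" "x \<in> rel_ideal (hecke_gens 2) (hecke_rels 2 0 1 q)"
  shows "sign_char q x = 0"
proof -
  have "rel_ideal (hecke_gens 2) (hecke_rels 2 0 1 q)
      \<subseteq> {p \<in> carrier (free_alg (hecke_gens 2)). 0 dvd sign_char q p}"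
    unfolding sign_char_def
  proof (rule rel_ideal_minimal[OF eval_dvd_ideal[OF scalar_hom_id]], fold sign_char_def)
    fix l r assume lr: "(l, r) \<in> hecke_rels 2 0 1 q"
    have "sign_char q (l - r) = 0"
      using lr assms(1)
      by (auto simp: hecke_rels_def sign_char_simps) (simp add: field_simps)
    then show "l - r \<in> {p \<in> carrier (free_alg (hecke_gens 2)). 0 dvd sign_char q p}"
      using hecke_rels_carrier[OF lr] by (simp add: free_alg_closed)
  qed
  then show ?thesis using assms(2) by auto
qed

text \<open>
  If \<open>q\<^sup>2 \<noteq> -1\<close>, the sign character does not vanish on the sign element.  If \<open>q\<^sup>2 = -1\<close>, the
  quadratic relation reads \<open>(T\<^sub>1 - q)\<^sup>2 = 0\<close>, and \<open>X\<^sub>1 \<mapsto> 0\<close>, \<open>T\<^sub>1 \<mapsto> x\<close> defines a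
  homomorphism to the polynomials in \<open>x\<close> modulo \<open>(x - q)\<^sup>2\<close>.  It sends the sign element to
  \<open>T\<^sub>1\<^sup>-\<^sup>1 (T\<^sub>1 - q)\<close>, a unit times \<open>x - q\<close>.
\<close>
lemma sign_elt_nonzero:
  assumes "q \<noteq> 0"
  shows "sign_elt q \<notin> rel_ideal (hecke_gens 2) (hecke_rels 2 0 1 q)"
proof (cases "q\<^sup>2 + 1 = 0")
  case False
  then show ?thesis using sign_char_rel_ideal[OF assms] sign_char_sign_elt[OF assms] by metis
next
  case True
  then have inv: "inverse q = - q" 
    using assms by (simp add: field_simps power2_eq_square add_eq_0_iff)
  interpret pscal: scalar_hom "\<lambda>c. [:c:] :: complex poly" by (rule scalar_hom_const_poly)
  define e where "e = eval (\<lambda>c. [:c:] :: complex poly) (case_hecke_gen 0 (\<lambda>_. [:0, 1:]))"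
  note e_simps = pscal.eval_simps[where f = "case_hecke_gen 0 (\<lambda>_. [:0, 1:])", folded e_def]
  let ?D = "[:-q, 1:]\<^sup>2"
  have "rel_ideal (hecke_gens 2) (hecke_rels 2 0 1 q)
      \<subseteq> {p \<in> carrier (free_alg (hecke_gens 2)). ?D dvd e p}"
    unfolding e_def
  proof (rule rel_ideal_minimal[OF eval_dvd_ideal[OF scalar_hom_const_poly]], fold e_def)
    fix l r assume lr: "(l, r) \<in> hecke_rels 2 0 1 q"
    have "?D = [:0, 1:] * [:0, 1:] - ([:q - inverse q:] * [:0, 1:] + 1)"
      using True by (simp add: inv power2_eq_square one_pCons add_eq_0_iff)
    then have "e (l - r) = 0 \<or> e (l - r) = ?D"
      using lr by (auto simp: hecke_rels_def e_simps simp del: mult_pCons_left mult_pCons_right)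
    then show "l - r \<in> {p \<in> carrier (free_alg (hecke_gens 2)). ?D dvd e p}"
      using hecke_rels_carrier[OF lr] by (auto simp: free_alg_closed)
  qed
  moreover have "\<not> ?D dvd e (sign_elt q)"
  proof
    assume D: "?D dvd e (sign_elt q)"
    have "e (sign_elt q) = [:- (q - inverse q), 1:] * [:-q, 1:]"
      by (simp add: sign_elt_def e_simps one_pCons)
    then have "[:-q, 1:] dvd [:- (q - inverse q), 1:]"
      using D by (simp add: power2_eq_square dvd_times_right_cancel_iff del: mult_pCons_left mult_pCons_right)
    then have "poly [:- (q - inverse q), 1:] q = 0"
      by (simp only: poly_eq_0_iff_dvd)
    then show False using assms by simp
  qed
  ultimately show ?thesis by auto
qed

lemma sign_class_nonzero:
  assumes "q \<noteq> 0"
  shows "hecke_class 2 0 1 q (sign_elt q) \<noteq> \<zero>\<^bsub>hecke_alg 2 0 1 q\<^esub>"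
proof -
  interpret H: hecke_map "hecke_alg 2 0 1 q" 2 "hecke_class 2 0 1 q" q
    using hecke_map_class assms by simp
  interpret presentation "hecke_gens 2" "hecke_rels 2 0 1 q" by (rule hecke_presentation)
  have "hecke_class 2 0 1 q (sign_elt q) \<noteq> hecke_class 2 0 1 q 0"
    unfolding hecke_class_def
    using class_eq_iff[of "sign_elt q" 0] sign_elt_nonzero[OF assms]
    by (simp add: sign_elt_closed free_alg_closed)
  then show ?thesis by (simp add: H.c_zero)
qed

text \<open>
  The square of the sign element is \<open>q\<^sup>2 + 1\<close> times itself, so for \<open>q\<^sup>2 = -1\<close> it spans a
  nonzero nilpotent ideal.
\<close>
lemma semisimple_imp_q:
  assumes q: "q \<noteq> 0" and ss: "semisimple_alg (hecke_alg 2 0 1 q)"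
  shows "q\<^sup>2 + 1 \<noteq> 0"
proof
  assume q2: "q\<^sup>2 + 1 = 0"
  interpret H: hecke_map "hecke_alg 2 0 1 q" 2 "hecke_class 2 0 1 q" q
    using hecke_map_class q by simp
  have zz: "H.Z \<otimes>\<^bsub>hecke_alg 2 0 1 q\<^esub> H.Z = \<zero>\<^bsub>hecke_alg 2 0 1 q\<^esub>"
    using H.Z_absorbs(1)[OF sign_elt_closed] sign_char_sign_elt[OF q] q2
    by (simp add: scal_simps H.c_zero)
  have "H.Z = \<zero>\<^bsub>hecke_alg 2 0 1 q\<^esub>"
  proof (rule semisimple_no_square_zero[OF H.R.ring_axioms ss])
    fix x assume "x \<in> carrier (hecke_alg 2 0 1 q)"
    then obtain p where "p \<in> carrier (free_alg (hecke_gens 2))" "x = hecke_class 2 0 1 q p"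
      using H.surj by blast
    then show "H.Z \<otimes>\<^bsub>hecke_alg 2 0 1 q\<^esub> x \<otimes>\<^bsub>hecke_alg 2 0 1 q\<^esub> H.Z = \<zero>\<^bsub>hecke_alg 2 0 1 q\<^esub>"
      using H.Z_absorbs(2)[of p] by (simp add: H.R.m_assoc zz)
  qed simp
  then show False using sign_class_nonzero[OF q] by simp
qed

section \<open>The minimal ideal of the sign representation\<close>

abbreviation (input) "H2 q \<equiv> hecke_alg 2 0 1 q"
abbreviation (input) "h2 q \<equiv> hecke_class 2 0 1 q"

definition is_sign_rep :: "complex \<Rightarrow> (hecke_gen free set \<Rightarrow> complex mat) \<Rightarrow> bool" where
  "is_sign_rep q \<rho> \<longleftrightarrow> \<rho> \<in> alg_hom (H2 q) (module_mat TYPE(complex) 1 1) \<and>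
     \<rho> (h2 q hX) = 0 \<cdot>\<^sub>m 1\<^sub>m 1 \<and> \<rho> (h2 q (hT 1)) = (- inverse q) \<cdot>\<^sub>m 1\<^sub>m 1"

lemma scalar_mat_simps:
  "(a \<cdot>\<^sub>m 1\<^sub>m n) * (b \<cdot>\<^sub>m 1\<^sub>m n) = (a * b) \<cdot>\<^sub>m (1\<^sub>m n :: complex mat)"
  "(a \<cdot>\<^sub>m 1\<^sub>m n) + (b \<cdot>\<^sub>m 1\<^sub>m n) = (a + b) \<cdot>\<^sub>m (1\<^sub>m n :: complex mat)"
  "a \<cdot>\<^sub>m (b \<cdot>\<^sub>m 1\<^sub>m n) = (a * b) \<cdot>\<^sub>m (1\<^sub>m n :: complex mat)"
  "1 \<cdot>\<^sub>m 1\<^sub>m n = (1\<^sub>m n :: complex mat)"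
proof -
  show s: "a \<cdot>\<^sub>m (b \<cdot>\<^sub>m 1\<^sub>m n) = (a * b) \<cdot>\<^sub>m (1\<^sub>m n :: complex mat)"
    by (intro eq_matI) auto
  have "(a \<cdot>\<^sub>m 1\<^sub>m n) * (b \<cdot>\<^sub>m 1\<^sub>m n) = a \<cdot>\<^sub>m (1\<^sub>m n * (b \<cdot>\<^sub>m 1\<^sub>m n :: complex mat))"
    by (rule mult_smult_assoc_mat[of _ n n _ n]) auto
  then show "(a \<cdot>\<^sub>m 1\<^sub>m n) * (b \<cdot>\<^sub>m 1\<^sub>m n) = (a * b) \<cdot>\<^sub>m (1\<^sub>m n :: complex mat)"
    by (simp add: left_mult_one_mat[of _ n n] s)
qed (auto intro!: eq_matI)

lemma h2_scal:
  assumes "p \<in> carrier (free_alg (hecke_gens 2))"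
  shows "c \<odot>\<^bsub>H2 q\<^esub> h2 q p = h2 q (scal c * p)"
proof -
  interpret presentation "hecke_gens 2" "hecke_rels 2 0 1 q" by (rule hecke_presentation)
  show ?thesis
    using class_hom assms unfolding alg_hom_def hecke_alg_def hecke_class_def by simp
qed

lemma sign_rep_eq:
  assumes q: "q \<noteq> 0" and \<rho>: "is_sign_rep q \<rho>" and p: "p \<in> carrier (free_alg (hecke_gens 2))"
  shows "\<rho> (h2 q p) = sign_char q p \<cdot>\<^sub>m 1\<^sub>m 1"
proof -
  interpret H: hecke_map "H2 q" 2 "h2 q" q
    using hecke_map_class q by simp
  have hom: "\<rho> \<in> Ring.ring_hom (H2 q) (module_mat TYPE(complex) 1 1)"
    and sm: "\<And>c x. x \<in> carrier (H2 q) \<Longrightarrow> \<rho> (c \<odot>\<^bsub>H2 q\<^esub> x) = c \<cdot>\<^sub>m \<rho> x"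
    using \<rho> by (auto simp: is_sign_rep_def alg_hom_def module_mat_simps)
  note hom = Ring.ring_hom_memE[OF hom, unfolded module_mat_simps]
  show ?thesis
    using p
  proof (induction rule: free_alg_induct)
    case (scal c)
    have "h2 q (scal c) = c \<odot>\<^bsub>H2 q\<^esub> \<one>\<^bsub>H2 q\<^esub>"
      using h2_scal[of 1 q c] by (simp add: free_alg_closed H.c_one)
    then show ?case using sm[of "\<one>\<^bsub>H2 q\<^esub>" c] hom(4) by (simp add: sign_char_simps)
  next
    case (gen g)
    have "g = HX \<or> g = HT 1" using gen by (auto simp: hecke_gens_def)
    then show ?case using \<rho> by (auto simp: is_sign_rep_def sign_char_simps)
  qed (simp_all add: H.c_simps hom sign_char_simps scalar_mat_simps)
qed

lemma sign_rep_exists: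
  assumes q: "q \<noteq> 0"
  shows "\<exists>\<rho>. is_sign_rep q \<rho>"
proof -
  interpret H: hecke_map "H2 q" 2 "h2 q" q
    using hecke_map_class q by simp
  interpret P: presentation "hecke_gens 2" "hecke_rels 2 0 1 q" by (rule hecke_presentation)
  let ?F = "carrier (free_alg (hecke_gens 2))"
  define \<rho> where "\<rho> C = sign_char q (inv_into ?F (h2 q) C) \<cdot>\<^sub>m (1\<^sub>m 1 :: complex mat)" for C
  have \<rho>: "\<rho> (h2 q p) = sign_char q p \<cdot>\<^sub>m 1\<^sub>m 1" if p: "p \<in> ?F" for p
  proof -
    let ?r = "inv_into ?F (h2 q) (h2 q p)"
    have r: "?r \<in> ?F" "h2 q ?r = h2 q p"
      using inv_into_into[OF imageI[OF p]] f_inv_into_f[OF imageI[OF p]] by blast+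
    then have "?r - p \<in> rel_ideal (hecke_gens 2) (hecke_rels 2 0 1 q)"
      using P.class_eq_iff p by (simp add: hecke_class_def)
    from sign_char_rel_ideal[OF q this] show ?thesis by (simp add: \<rho>_def sign_char_simps)
  qed
  have "\<rho> \<in> alg_hom (H2 q) (module_mat TYPE(complex) 1 1)"
    unfolding alg_hom_def
  proof (intro CollectI conjI allI ballI Ring.ring_hom_memI)
    show "\<rho> x \<in> carrier (module_mat TYPE(complex) 1 1)" if "x \<in> carrier (H2 q)" for x
      by (simp add: \<rho>_def module_mat_simps)
    show "\<rho> \<one>\<^bsub>H2 q\<^esub> = \<one>\<^bsub>module_mat TYPE(complex) 1 1\<^esub>"
      using \<rho>[of 1] by (simp add: free_alg_closed H.c_one module_mat_simps sign_char_simps scalar_mat_simps)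
  next
    fix x y assume "x \<in> carrier (H2 q)" "y \<in> carrier (H2 q)"
    then obtain p r where pr: "p \<in> ?F" "x = h2 q p" "r \<in> ?F" "y = h2 q r"
      unfolding H.surj[symmetric] by blast
    then show "\<rho> (x \<otimes>\<^bsub>H2 q\<^esub> y) = \<rho> x \<otimes>\<^bsub>module_mat TYPE(complex) 1 1\<^esub> \<rho> y"
      "\<rho> (x \<oplus>\<^bsub>H2 q\<^esub> y) = \<rho> x \<oplus>\<^bsub>module_mat TYPE(complex) 1 1\<^esub> \<rho> y"
      using \<rho>[of "p * r"] \<rho>[of "p + r"] \<rho>[of p] \<rho>[of r]
      by (simp_all add: H.c_simps free_alg_closed module_mat_simps sign_char_simps
          scalar_mat_simps)
  next
    fix c x assume "x \<in> carrier (H2 q)"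
    then obtain p where "p \<in> ?F" "x = h2 q p" using H.surj by blast
    then show "\<rho> (c \<odot>\<^bsub>H2 q\<^esub> x) = c \<odot>\<^bsub>module_mat TYPE(complex) 1 1\<^esub> \<rho> x"
      using \<rho>[of "scal c * p"] \<rho>[of p]
      by (simp add: h2_scal free_alg_closed module_mat_simps sign_char_simps scalar_mat_simps)
  qed
  then show ?thesis
    unfolding is_sign_rep_def using \<rho>[of hX] \<rho>[of "hT 1"]
    by (intro exI[of _ \<rho>]) (simp add: sign_char_simps)
qed

definition sign_line :: "complex \<Rightarrow> hecke_gen free set set" where
  "sign_line q = range (\<lambda>c. h2 q (scal c * sign_elt q))"

lemma sign_line_ideal:
  assumes q: "q \<noteq> 0"
  shows "ideal (sign_line q) (H2 q)"
proof -
  interpret H: hecke_map "H2 q" 2 "h2 q" q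
    using hecke_map_class q by simp
  have el: "h2 q (scal c * sign_elt q) = h2 q (scal c) \<otimes>\<^bsub>H2 q\<^esub> H.Z" for c
    by (simp add: H.c_mult free_alg_closed sign_elt_closed)
  have in_line: "h2 q (scal c) \<otimes>\<^bsub>H2 q\<^esub> H.Z \<in> sign_line q" for c
    unfolding sign_line_def el by blast
  show ?thesis
  proof (rule idealI[OF H.R.ring_axioms])
    show "subgroup (sign_line q) (add_monoid (H2 q))"
    proof (rule H.R.add.subgroupI)
      show "sign_line q \<subseteq> carrier (H2 q)" "sign_line q \<noteq> {}"
        by (auto simp: sign_line_def el)
      fix x assume "x \<in> sign_line q"
      then obtain c where c: "x = h2 q (scal c) \<otimes>\<^bsub>H2 q\<^esub> H.Z" by (auto simp: sign_line_def el)
      have "h2 q (scal (- c)) \<oplus>\<^bsub>H2 q\<^esub> h2 q (scal c) = \<zero>\<^bsub>H2 q\<^esub>"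
        by (simp add: scal_simps H.c_zero free_alg_closed flip: H.c_add)
      then have "h2 q (scal (- c)) = \<ominus>\<^bsub>H2 q\<^esub> h2 q (scal c)"
        by (intro H.R.minus_equality[symmetric]) simp_all
      then show "\<ominus>\<^bsub>H2 q\<^esub> x \<in> sign_line q"
        using in_line[of "- c"] c by (simp add: H.R.l_minus)
      fix y assume "y \<in> sign_line q"
      then obtain e where e: "y = h2 q (scal e) \<otimes>\<^bsub>H2 q\<^esub> H.Z" by (auto simp: sign_line_def el)
      show "x \<oplus>\<^bsub>H2 q\<^esub> y \<in> sign_line q"
        using in_line[of "c + e"] c e
        by (simp add: H.R.l_distr H.c_add free_alg_closed flip: scal_simps(2))
    qed
  next
    fix x y assume "x \<in> sign_line q" "y \<in> carrier (H2 q)"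
    then obtain c where c: "x = h2 q (scal c) \<otimes>\<^bsub>H2 q\<^esub> H.Z" by (auto simp: sign_line_def el)
    obtain p where p: "p \<in> carrier (free_alg (hecke_gens 2))" "y = h2 q p"
      using H.surj \<open>y \<in> carrier (H2 q)\<close> by blast
    have cc: "y \<otimes>\<^bsub>H2 q\<^esub> h2 q (scal c) = h2 q (scal c) \<otimes>\<^bsub>H2 q\<^esub> y"
      using p by (intro H.c_scal_central) simp
    have eq: "h2 q (scal (c * sign_char q p)) \<otimes>\<^bsub>H2 q\<^esub> H.Z
        = h2 q (scal c) \<otimes>\<^bsub>H2 q\<^esub> (h2 q (scal (sign_char q p)) \<otimes>\<^bsub>H2 q\<^esub> H.Z)"
      by (simp add: H.R.m_assoc H.c_mult free_alg_closed flip: scal_simps(1))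
    have "x \<otimes>\<^bsub>H2 q\<^esub> y = h2 q (scal c) \<otimes>\<^bsub>H2 q\<^esub> (H.Z \<otimes>\<^bsub>H2 q\<^esub> y)"
      using p c by (simp add: H.R.m_assoc)
    then show "x \<otimes>\<^bsub>H2 q\<^esub> y \<in> sign_line q"
      using in_line[of "c * sign_char q p"] H.Z_absorbs(2)[OF p(1)] p(2) eq by simp
    have "y \<otimes>\<^bsub>H2 q\<^esub> x = (y \<otimes>\<^bsub>H2 q\<^esub> h2 q (scal c)) \<otimes>\<^bsub>H2 q\<^esub> H.Z"
      using p c by (simp add: H.R.m_assoc)
    also have "\<dots> = h2 q (scal c) \<otimes>\<^bsub>H2 q\<^esub> (y \<otimes>\<^bsub>H2 q\<^esub> H.Z)"
      using p unfolding cc by (simp add: H.R.m_assoc)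
    finally show "y \<otimes>\<^bsub>H2 q\<^esub> x \<in> sign_line q"
      using in_line[of "c * sign_char q p"] H.Z_absorbs(1)[OF p(1)] p(2) eq by simp
  qed
qed

lemma sign_line_minimal:
  assumes q: "q \<noteq> 0" and J: "ideal J (H2 q)" "x \<in> J" "x \<in> sign_line q" "x \<noteq> \<zero>\<^bsub>H2 q\<^esub>"
  shows "sign_line q \<subseteq> J"
proof -
  interpret H: hecke_map "H2 q" 2 "h2 q" q
    using hecke_map_class q by simp
  obtain c where c: "x = h2 q (scal c * sign_elt q)" using J(3) by (auto simp: sign_line_def)
  have "c \<noteq> 0" using J(4) by (auto simp: c scal_simps H.c_zero)
  have "h2 q (scal e * sign_elt q) \<in> J" for e
  proof -
    have "h2 q (scal e * sign_elt q) = h2 q (scal (e / c) * (scal c * sign_elt q))"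
      using \<open>c \<noteq> 0\<close> by (simp add: scal_simps flip: mult.assoc)
    also have "\<dots> = h2 q (scal (e / c)) \<otimes>\<^bsub>H2 q\<^esub> x"
      unfolding c by (rule H.c_mult) (simp_all add: free_alg_closed sign_elt_closed)
    also have "\<dots> \<in> J" by (rule ideal.I_l_closed[OF J(1,2)]) simp
    finally show ?thesis .
  qed
  then show ?thesis by (auto simp: sign_line_def)
qed

lemma sign_elt_in_line: "h2 q (sign_elt q) \<in> sign_line q"
  unfolding sign_line_def by (rule image_eqI[of _ _ 1]) (simp_all add: scal_simps)

text \<open>
  If \<open>J\<close> contains \<open>x\<close> on which the sign representation is nonzero, it contains the product of
  \<open>x\<close> and the sign element, a nonzero multiple of the latter.  So \<open>J\<close> contains
  \<open>sign_line q\<close>, and equals it by minimality.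
\<close>
lemma corresponding_imp_sign_line:
  assumes q: "q \<noteq> 0" and \<rho>: "is_sign_rep q \<rho>"
    and J: "corresponding_minimal_ideal (H2 q) 1 \<rho> J"
  shows "J = sign_line q"
proof -
  interpret H: hecke_map "H2 q" 2 "h2 q" q
    using hecke_map_class q by simp
  have min: "minimal_ideal J (H2 q)" and "\<exists>x \<in> J. \<rho> x \<noteq> 0\<^sub>m 1 1"
    using J by (auto simp: corresponding_minimal_ideal_def)
  then obtain x where x: "x \<in> J" "\<rho> x \<noteq> 0\<^sub>m 1 1" by blast
  interpret J: ideal J "H2 q" using min by (simp add: minimal_ideal_def)
  obtain p where p: "p \<in> carrier (free_alg (hecke_gens 2))" "x = h2 q p"
    using x(1) J.a_subset H.surj by blast
  have nz: "sign_char q p \<noteq> 0"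
    using x(2) sign_rep_eq[OF q \<rho> p(1)] p(2) by auto
  have "h2 q (scal (sign_char q p) * sign_elt q) = x \<otimes>\<^bsub>H2 q\<^esub> H.Z"
    unfolding p(2) H.Z_absorbs(1)[OF p(1)] by (rule H.c_mult) (simp_all add: free_alg_closed sign_elt_closed)
  then have inJ: "h2 q (scal (sign_char q p) * sign_elt q) \<in> J"
    using J.I_r_closed[OF x(1), of "H.Z"] by simp
  have "h2 q (scal (inverse (sign_char q p)) * (scal (sign_char q p) * sign_elt q)) = H.Z"
    using nz by (simp add: scal_simps flip: mult.assoc)
  then have "h2 q (scal (sign_char q p) * sign_elt q) \<noteq> \<zero>\<^bsub>H2 q\<^esub>"
    using sign_class_nonzero[OF q] H.c_mult[of "scal (inverse (sign_char q p))" "scal (sign_char q p) * sign_elt q"]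
    by (auto simp: free_alg_closed sign_elt_closed)
  then have "sign_line q \<subseteq> J"
    by (intro sign_line_minimal[OF q _ inJ]) (auto simp: sign_line_def J.ideal_axioms)
  then show "J = sign_line q"
    using min sign_line_ideal[OF q] sign_elt_in_line[of q] sign_class_nonzero[OF q]
    unfolding minimal_ideal_def by blast
qed

text \<open>
  A nonzero column \<open>w\<close> of the image of the sign element under \<open>\<sigma>\<close> spans a line on which \<open>H\<^sub>2\<close>
  acts by the sign character.  The line is invariant, so by irreducibility it is the whole space
  and \<open>\<sigma>\<close> is the sign representation.
\<close>
lemma other_reps_vanish:
  assumes q: "q \<noteq> 0" and \<rho>: "is_sign_rep q \<rho>"
    and \<sigma>: "irreducible_rep (H2 q) m \<sigma>" and nz: "\<sigma> (h2 q (sign_elt q)) \<noteq> 0\<^sub>m m m"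
  shows "equivalent_reps (H2 q) 1 \<rho> m \<sigma>"
proof -
  interpret H: hecke_map "H2 q" 2 "h2 q" q
    using hecke_map_class q by simp
  let ?z = "\<sigma> H.Z"
  have hom: "\<sigma> \<in> Ring.ring_hom (H2 q) (module_mat TYPE(complex) m m)"
    and sm: "\<And>c x. x \<in> carrier (H2 q) \<Longrightarrow> \<sigma> (c \<odot>\<^bsub>H2 q\<^esub> x) = c \<cdot>\<^sub>m \<sigma> x"
    and irr: "\<And>W. invariant_subspace (H2 q) m \<sigma> W \<Longrightarrow> W = {0\<^sub>v m} \<or> W = carrier_vec m"
    and m0: "m > 0"
    using \<sigma> by (auto simp: irreducible_rep_def alg_hom_def module_mat_simps)
  note hom = Ring.ring_hom_memE[OF hom, unfolded module_mat_simps]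
  have zc: "?z \<in> carrier_mat m m" by (rule hom(1)) simp
  obtain i j where ij: "i < m" "j < m" "?z $$ (i, j) \<noteq> 0"
    using nz zc by (metis carrier_matD eq_matI index_zero_mat)
  define w where "w = col ?z j"
  have w: "w \<in> carrier_vec m" "w $ i \<noteq> 0"
    using zc ij by (auto simp: w_def)
  then have w0: "w \<noteq> 0\<^sub>v m" using ij(1) by auto
  have act: "\<sigma> (h2 q p) *\<^sub>v w = sign_char q p \<cdot>\<^sub>v w" if p: "p \<in> carrier (free_alg (hecke_gens 2))" for p
  proof -
    have pc: "\<sigma> (h2 q p) \<in> carrier_mat m m" using p by (intro hom(1)) simp
    have "\<sigma> (h2 q p) * ?z = \<sigma> (h2 q p \<otimes>\<^bsub>H2 q\<^esub> H.Z)" using p by (simp add: hom)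
    also have "h2 q p \<otimes>\<^bsub>H2 q\<^esub> H.Z = h2 q (scal (sign_char q p) * sign_elt q)"
      unfolding H.Z_absorbs(1)[OF p]
      by (rule H.c_mult[symmetric]) (simp_all add: free_alg_closed sign_elt_closed)
    also have "\<dots> = sign_char q p \<odot>\<^bsub>H2 q\<^esub> H.Z"
      by (simp add: h2_scal sign_elt_closed)
    also have "\<sigma> \<dots> = sign_char q p \<cdot>\<^sub>m ?z" by (simp add: sm)
    finally have "col (\<sigma> (h2 q p) * ?z) j = col (sign_char q p \<cdot>\<^sub>m ?z) j" by simp
    then show ?thesis
      unfolding col_mult2[OF pc zc ij(2)] using zc ij(2) by (simp add: w_def)
  qed
  let ?W = "range (\<lambda>c. c \<cdot>\<^sub>v w)"
  have "invariant_subspace (H2 q) m \<sigma> ?W"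
    unfolding invariant_subspace_def
  proof (intro conjI ballI allI)
    show "?W \<subseteq> carrier_vec m" using w by auto
    show "0\<^sub>v m \<in> ?W" using w(1) by (intro image_eqI[of _ _ 0]) auto
    show "v + v' \<in> ?W" if "v \<in> ?W" "v' \<in> ?W" for v v'
      using that by (auto simp: add_smult_distrib_vec[symmetric])
    show "c \<cdot>\<^sub>v v \<in> ?W" if "v \<in> ?W" for c v
      using that by (auto simp: smult_smult_assoc)
    fix x v assume "x \<in> carrier (H2 q)" "v \<in> ?W"
    then obtain p c where p: "p \<in> carrier (free_alg (hecke_gens 2))" "x = h2 q p" "v = c \<cdot>\<^sub>v w"
      unfolding H.surj[symmetric] by blast
    have pc: "\<sigma> (h2 q p) \<in> carrier_mat m m" using p by (intro hom(1)) simp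
    have "\<sigma> x *\<^sub>v v = c \<cdot>\<^sub>v (sign_char q p \<cdot>\<^sub>v w)"
      unfolding p(2,3) act[OF p(1), symmetric] by (rule mult_mat_vec[OF pc w(1)])
    then show "\<sigma> x *\<^sub>v v \<in> ?W" by (auto simp: smult_smult_assoc)
  qed
  moreover have "w \<in> ?W" by (intro image_eqI[of _ _ 1]) auto
  ultimately have W: "?W = carrier_vec m" using irr[of ?W] w0 by blast
  have "m = 1"
  proof (rule ccontr)
    assume "m \<noteq> 1"
    define j' where "j' = (if i = 0 then 1 else 0 :: nat)"
    have j': "j' < m" "j' \<noteq> i" using m0 \<open>m \<noteq> 1\<close> by (auto simp: j'_def)
    have "unit_vec m j' \<in> ?W" unfolding W by simp
    then obtain c where c: "unit_vec m j' = c \<cdot>\<^sub>v w" by blast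
    have "c * w $ i = (unit_vec m j' :: complex vec) $ i"
      unfolding c using w(1) ij(1) by simp
    moreover have "c * w $ j' = (unit_vec m j' :: complex vec) $ j'"
      unfolding c using w(1) j'(1) by simp
    ultimately show False using w(2) ij(1) j' by simp
  qed
  have i0: "i = 0" using ij(1) \<open>m = 1\<close> by simp
  have "\<rho> x = \<sigma> x" if x: "x \<in> carrier (H2 q)" for x
  proof -
    obtain p where p: "p \<in> carrier (free_alg (hecke_gens 2))" "x = h2 q p"
      using x unfolding H.surj[symmetric] by blast
    have "h2 q p \<in> carrier (H2 q)" using p(1) by simp
    then have pc: "\<sigma> (h2 q p) \<in> carrier_mat 1 1" using hom(1) unfolding \<open>m = 1\<close> by blast
    have "(\<sigma> (h2 q p) *\<^sub>v w) $ 0 = \<sigma> (h2 q p) $$ (0, 0) * w $ 0"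
      using pc w(1) unfolding \<open>m = 1\<close> by (simp add: scalar_prod_def)
    moreover have "(\<sigma> (h2 q p) *\<^sub>v w) $ 0 = sign_char q p * w $ 0"
      unfolding act[OF p(1)] using w(1) unfolding \<open>m = 1\<close> by simp
    ultimately have "\<sigma> x $$ (0, 0) = sign_char q p"
      using w(2) unfolding i0 p(2) by simp
    then have "\<sigma> x = sign_char q p \<cdot>\<^sub>m 1\<^sub>m 1"
      using pc p(2) by (intro eq_matI) auto
    then show ?thesis using sign_rep_eq[OF q \<rho> p(1)] p(2) by simp
  qed
  moreover have "1\<^sub>m 1 * \<sigma> x = \<sigma> x * 1\<^sub>m 1" if "x \<in> carrier (H2 q)" for x
    using hom(1)[OF that] unfolding \<open>m = 1\<close>
    by (simp only: left_mult_one_mat right_mult_one_mat)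
  moreover have "invertible_mat (1\<^sub>m 1 :: complex mat)"
    unfolding invertible_mat_def inverts_mat_def by (auto intro!: exI[of _ "1\<^sub>m 1"])
  ultimately show ?thesis
    unfolding equivalent_reps_def using \<open>m = 1\<close>
    by (intro conjI bexI[of _ "1\<^sub>m 1"]) auto
qed

lemma sign_line_corresponds:
  assumes q: "q \<noteq> 0" and q2: "q\<^sup>2 + 1 \<noteq> 0" and \<rho>: "is_sign_rep q \<rho>"
  shows "corresponding_minimal_ideal (H2 q) 1 \<rho> (sign_line q)"
proof -
  interpret H: hecke_map "H2 q" 2 "h2 q" q
    using hecke_map_class q by simp
  have "minimal_ideal (sign_line q) (H2 q)"
    unfolding minimal_ideal_def
  proof (intro conjI allI impI)
    show "ideal (sign_line q) (H2 q)" by (rule sign_line_ideal[OF q])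
    show "sign_line q \<noteq> {\<zero>\<^bsub>H2 q\<^esub>}"
      using sign_elt_in_line[of q] sign_class_nonzero[OF q] by auto
    fix J assume J: "ideal J (H2 q) \<and> J \<subseteq> sign_line q"
    then interpret J: ideal J "H2 q" by simp
    show "J = {\<zero>\<^bsub>H2 q\<^esub>} \<or> J = sign_line q"
      using sign_line_minimal[OF q J.ideal_axioms] J J.zero_closed by blast
  qed
  moreover have "\<exists>x \<in> sign_line q. \<rho> x \<noteq> 0\<^sub>m 1 1"
  proof (intro bexI[of _ "H.Z"] sign_elt_in_line)
    have "\<rho> H.Z $$ (0, 0) = q\<^sup>2 + 1"
      using sign_rep_eq[OF q \<rho> sign_elt_closed] sign_char_sign_elt[OF q] by simp
    then show "\<rho> H.Z \<noteq> 0\<^sub>m 1 1" using q2 by auto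
  qed
  moreover have "\<sigma> x = 0\<^sub>m m m"
    if \<sigma>: "irreducible_rep (H2 q) m \<sigma>" "\<not> equivalent_reps (H2 q) 1 \<rho> m \<sigma>" and x: "x \<in> sign_line q"
    for m \<sigma> x
  proof -
    have "\<sigma> H.Z = 0\<^sub>m m m" using other_reps_vanish[OF q \<rho> \<sigma>(1)] \<sigma>(2) by blast
    moreover obtain c where "x = c \<odot>\<^bsub>H2 q\<^esub> H.Z"
      using x by (auto simp: sign_line_def h2_scal sign_elt_closed)
    ultimately show ?thesis
      using \<sigma>(1) by (simp add: irreducible_rep_def alg_hom_def module_mat_simps)
  qed
  ultimately show ?thesis by (auto simp: corresponding_minimal_ideal_def)
qed

lemma hecke_sign_ideal_eq:
  assumes q: "q \<noteq> 0" and ss: "semisimple_alg (H2 q)"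
  shows "hecke_sign_ideal 0 1 q = sign_line q"
proof -
  obtain \<rho> where \<rho>: "is_sign_rep q \<rho>" using sign_rep_exists[OF q] by blast
  have "(\<exists>\<rho> \<in> alg_hom (H2 q) (module_mat TYPE(complex) 1 1).
        \<rho> (h2 q hX) = 0 \<cdot>\<^sub>m 1\<^sub>m 1 \<and> \<rho> (h2 q (hT 1)) = (- inverse q) \<cdot>\<^sub>m 1\<^sub>m 1 \<and>
        corresponding_minimal_ideal (H2 q) 1 \<rho> J) \<longleftrightarrow> J = sign_line q" for J
    using corresponding_imp_sign_line[OF q] sign_line_corresponds[OF q semisimple_imp_q[OF q ss] \<rho>] \<rho>
    unfolding is_sign_rep_def by blast
  then show ?thesis unfolding hecke_sign_ideal_def by simp
qed

section \<open>The mutually inverse homomorphisms\<close>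

text \<open>
  The elements of the Hecke algebra that become the generators \<open>P\<^sub>i\<close>, numbered from \<open>1\<close>.
\<close>
fun hecke_P :: "complex \<Rightarrow> nat \<Rightarrow> hecke_gen free" where
  "hecke_P q (Suc (Suc i)) =
     scal q * hecke_P q (Suc i) * (hT (Suc i) - scal (q - inverse q)) * hecke_P q (Suc i)"
| "hecke_P q _ = 1 - hX"

definition to_rook :: "hecke_gen free \<Rightarrow> rook_gen free" where
  "to_rook = eval scal (case_hecke_gen (1 - rP 1) rT)"

definition to_hecke :: "complex \<Rightarrow> rook_gen free \<Rightarrow> hecke_gen free" where
  "to_hecke q = eval scal (case_rook_gen (hecke_P q) hT)"

lemmas to_rook_simps = scal.eval_simps[where f = "case_hecke_gen (1 - rP 1) rT", folded to_rook_def]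
lemmas to_hecke_simps =
  scal.eval_simps[where f = "case_rook_gen (hecke_P q) hT" for q, folded to_hecke_def]

lemma hecke_P_closed: "i \<le> k \<Longrightarrow> hecke_P q i \<in> carrier (free_alg (hecke_gens k))"
  by (induction q i rule: hecke_P.induct) (auto intro!: free_alg_closed simp: hecke_gens_def)

lemma to_rook_closed:
  assumes "1 \<le> k" "p \<in> carrier (free_alg (hecke_gens k))"
  shows "to_rook p \<in> carrier (free_alg (rook_gens k))"
  unfolding to_rook_def
  by (rule eval_closed[OF assms(2)])
    (use assms(1) in \<open>auto simp: hecke_gens_def rook_gens_def intro!: free_alg_closed\<close>)

lemma to_hecke_closed:
  assumes "p \<in> carrier (free_alg (rook_gens k))"
  shows "to_hecke q p \<in> carrier (free_alg (hecke_gens k))"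
  unfolding to_hecke_def
  by (rule eval_closed[OF assms])
    (auto simp: rook_gens_def hecke_P_closed intro!: gens_closed(2))

lemma to_hecke_to_rook:
  assumes "p \<in> carrier (free_alg (hecke_gens k))"
  shows "to_hecke q (to_rook p) = p"
  using assms
proof (induction rule: free_alg_induct)
  case (gen g)
  then show ?case by (auto simp: hecke_gens_def to_rook_simps to_hecke_simps)
qed (simp_all add: to_rook_simps to_hecke_simps)

text \<open>
  Each proof selects the family explicitly.  An equation between words in the free algebra does
  not reveal to proof search which family it belongs to.
\<close>
lemma rook_relsI:
  "1 \<le> i \<Longrightarrow> i \<le> k - 1 \<Longrightarrow> (rT i * rT i, scal (q - inverse q) * rT i + 1) \<in> rook_rels k q"
  "1 \<le> i \<Longrightarrow> i + 1 \<le> k - 1 \<Longrightarrow> (rT i * rT (i+1) * rT i, rT (i+1) * rT i * rT (i+1)) \<in> rook_rels k q"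
  "i \<in> {1..k - 1} \<Longrightarrow> j \<in> {1..k - 1} \<Longrightarrow> i + 1 < j \<or> j + 1 < i \<Longrightarrow> (rT i * rT j, rT j * rT i) \<in> rook_rels k q"
  "1 \<le> i \<Longrightarrow> i \<le> k \<Longrightarrow> (rP i * rP i, rP i) \<in> rook_rels k q"
  "1 \<le> i \<Longrightarrow> i < j \<Longrightarrow> j \<le> k - 1 \<Longrightarrow> (rP i * rT j, rT j * rP i) \<in> rook_rels k q"
  "1 \<le> j \<Longrightarrow> j < i \<Longrightarrow> i \<le> k \<Longrightarrow> (rP i * rT j, rT j * rP i) \<in> rook_rels k q"
  "1 \<le> j \<Longrightarrow> j < i \<Longrightarrow> i \<le> k \<Longrightarrow> (rT j * rP i, scal q * rP i) \<in> rook_rels k q"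
  "1 \<le> i \<Longrightarrow> i \<le> k - 1 \<Longrightarrow> (rP (i+1), scal q * rP i * (rT i - scal (q - inverse q)) * rP i) \<in> rook_rels k q"
proof -
  show "(rT i * rT i, scal (q - inverse q) * rT i + 1) \<in> rook_rels k q"
    if "1 \<le> i" "i \<le> k - 1"
    unfolding rook_rels_def by (rule UnI1, rule UnI1, rule UnI1, rule UnI1, rule UnI1,
        rule UnI1, rule UnI1, rule UnI1, rule UnI1, insert that, blast)
  show "(rT i * rT (i+1) * rT i, rT (i+1) * rT i * rT (i+1)) \<in> rook_rels k q"
    if "1 \<le> i" "i + 1 \<le> k - 1"
    unfolding rook_rels_def by (rule UnI1, rule UnI1, rule UnI1, rule UnI1, rule UnI1,
        rule UnI1, rule UnI1, rule UnI1, rule UnI2, insert that, blast)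
  show "(rT i * rT j, rT j * rT i) \<in> rook_rels k q"
    if "i \<in> {1..k - 1}" "j \<in> {1..k - 1}" "i + 1 < j \<or> j + 1 < i"
    unfolding rook_rels_def by (rule UnI1, rule UnI1, rule UnI1, rule UnI1, rule UnI1,
        rule UnI1, rule UnI1, rule UnI2, insert that, blast)
  show "(rP i * rP i, rP i) \<in> rook_rels k q" if "1 \<le> i" "i \<le> k"
    unfolding rook_rels_def by (rule UnI1, rule UnI1, rule UnI1, rule UnI1, rule UnI1,
        rule UnI1, rule UnI2, insert that, blast)
  show "(rP i * rT j, rT j * rP i) \<in> rook_rels k q" if "1 \<le> i" "i < j" "j \<le> k - 1"
    unfolding rook_rels_def by (rule UnI1, rule UnI1, rule UnI1, rule UnI1, rule UnI2,
        insert that, blast)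
  show "(rP i * rT j, rT j * rP i) \<in> rook_rels k q" if "1 \<le> j" "j < i" "i \<le> k"
    unfolding rook_rels_def by (rule UnI1, rule UnI1, rule UnI1, rule UnI2, insert that, blast)
  show "(rT j * rP i, scal q * rP i) \<in> rook_rels k q" if "1 \<le> j" "j < i" "i \<le> k"
    unfolding rook_rels_def by (rule UnI1, rule UnI1, rule UnI2, insert that, blast)
  show "(rP (i+1), scal q * rP i * (rT i - scal (q - inverse q)) * rP i) \<in> rook_rels k q"
    if "1 \<le> i" "i \<le> k - 1"
    unfolding rook_rels_def by (rule UnI1, rule UnI2, insert that, blast)
qed

text \<open>
  The relations of the Hecke algebra hold in the rook monoid algebra with \<open>X\<^sub>1 = 1 - P\<^sub>1\<close>.  Most
  are literally relations there.  Since \<open>P\<^sub>2 = q Y\<close> with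
  \<open>Y = P\<^sub>1 T\<^sub>1\<^sup>-\<^sup>1 P\<^sub>1\<close>, the relations \<open>P\<^sub>2 T\<^sub>1 = T\<^sub>1 P\<^sub>2 = q P\<^sub>2\<close> give \<open>Y T\<^sub>1 = T\<^sub>1 Y = q Y\<close>.  The first
  equality is the relation of length 4 by \<open>commutator\<close>, and \<open>Y (T\<^sub>1 - q) = 0\<close> kills the sign
  element.
\<close>
lemma rook_hecke_relations:
  assumes q: "q \<noteq> 0" and k: "2 \<le> k"
  defines "\<tau> \<equiv> \<lambda>p. rook_class k q (to_rook p)"
  shows "free_alg_map (rook_alg k q) (hecke_gens k) \<tau>"
    and "\<And>l r. (l, r) \<in> hecke_rels k 0 1 q \<Longrightarrow> \<tau> l = \<tau> r"
    and "\<tau> (sign_elt q) = \<zero>\<^bsub>rook_alg k q\<^esub>"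
proof -
  let ?R = "rook_alg k q" and ?c = "rook_class k q" and ?F = "carrier (free_alg (rook_gens k))"
  interpret P: presentation "rook_gens k" "rook_rels k q" by (rule rook_presentation)
  interpret M: free_alg_map ?R "rook_gens k" ?c
    using P.free_alg_map by (simp add: rook_alg_def rook_class_def)
  have surj: "?c ` ?F = carrier ?R"
    using P.class_surj by (simp add: rook_alg_def rook_class_def)
  have rel: "?c l = ?c r" if "(l, r) \<in> rook_rels k q" for l r
    using P.class_rel that rook_rels_carrier[OF that] by (simp add: rook_class_def)
  have closed: "to_rook p \<in> ?F" if "p \<in> carrier (free_alg (hecke_gens k))" for p
    using to_rook_closed[OF _ that] k by simp
  have "\<tau> \<in> Ring.ring_hom (free_alg (hecke_gens k)) ?R"
  proof (rule Ring.ring_hom_memI)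
    fix x y assume "x \<in> carrier (free_alg (hecke_gens k))" "y \<in> carrier (free_alg (hecke_gens k))"
    then show "\<tau> (x \<otimes>\<^bsub>free_alg (hecke_gens k)\<^esub> y) = \<tau> x \<otimes>\<^bsub>?R\<^esub> \<tau> y"
      "\<tau> (x \<oplus>\<^bsub>free_alg (hecke_gens k)\<^esub> y) = \<tau> x \<oplus>\<^bsub>?R\<^esub> \<tau> y"
      by (simp_all add: \<tau>_def to_rook_simps M.c_simps closed)
  qed (simp_all add: \<tau>_def to_rook_simps M.c_one closed)
  then show "free_alg_map (rook_alg k q) (hecke_gens k) \<tau>"
    by (simp add: free_alg_map_def free_alg_map_axioms_def ring_free_alg M.R.ring_axioms)
  let ?a = "?c (scal q)" and ?b = "?c (scal (inverse q))"
  let ?d = "?c (scal (q - inverse q))"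
  let ?P = "?c (rP 1)" and ?T = "?c (rT 1)" and ?P2 = "?c (rP 2)"
  have closed' [simp]: "rP 1 \<in> ?F" "rT 1 \<in> ?F" "rP 2 \<in> ?F" "scal e \<in> ?F"
    "rP (Suc 0) \<in> ?F" "rT (Suc 0) \<in> ?F" for e
    using k gens_closed(3,4)[of 1 k] by (simp_all add: free_alg_closed)
  have carr [simp]: "?P \<in> carrier ?R" "?T \<in> carrier ?R" "?P2 \<in> carrier ?R" "?c (scal e) \<in> carrier ?R" for e
    by simp_all
  have cent: "x \<otimes>\<^bsub>?R\<^esub> ?c (scal e) = ?c (scal e) \<otimes>\<^bsub>?R\<^esub> x" if x: "x \<in> carrier ?R" for x e
  proof -
    obtain p where p: "p \<in> ?F" "x = ?c p" using x unfolding surj[symmetric] by blast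
    then have "?c (p * scal e) = ?c (scal e * p)" by (simp only: scal_central)
    then show ?thesis using p by (simp add: M.c_mult)
  qed
  have PP: "?P \<otimes>\<^bsub>?R\<^esub> ?P = ?P"
  proof -
    have "(rP 1 * rP 1, rP 1) \<in> rook_rels k q" by (rule rook_relsI) (use k in auto)
    then have "?c (rP 1 * rP 1) = ?c (rP 1)" by (rule rel)
    then show ?thesis by (simp add: M.c_mult)
  qed
  have TT: "?T \<otimes>\<^bsub>?R\<^esub> ?T = ?d \<otimes>\<^bsub>?R\<^esub> ?T \<oplus>\<^bsub>?R\<^esub> \<one>\<^bsub>?R\<^esub>"
  proof -
    have "(rT 1 * rT 1, scal (q - inverse q) * rT 1 + 1) \<in> rook_rels k q"
      by (rule rook_relsI) (use k in auto)
    then have "?c (rT 1 * rT 1) = ?c (scal (q - inverse q) * rT 1 + 1)" by (rule rel)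
    then show ?thesis by (simp add: M.c_simps free_alg_closed)
  qed
  have PT2: "?P2 \<otimes>\<^bsub>?R\<^esub> ?T = ?a \<otimes>\<^bsub>?R\<^esub> ?P2" and TP2: "?T \<otimes>\<^bsub>?R\<^esub> ?P2 = ?a \<otimes>\<^bsub>?R\<^esub> ?P2"
  proof -
    have 1: "?c (rP 2 * rT 1) = ?c (rT 1 * rP 2)"
      by (rule rel, rule rook_relsI(6)) (use k in auto)
    have "?c (rT 1 * rP 2) = ?c (scal q * rP 2)"
      by (rule rel, rule rook_relsI(7)) (use k in auto)
    with 1 show "?P2 \<otimes>\<^bsub>?R\<^esub> ?T = ?a \<otimes>\<^bsub>?R\<^esub> ?P2" "?T \<otimes>\<^bsub>?R\<^esub> ?P2 = ?a \<otimes>\<^bsub>?R\<^esub> ?P2"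
      by (simp_all add: M.c_mult)
  qed
  define Y where "Y = ?P \<otimes>\<^bsub>?R\<^esub> (?T \<ominus>\<^bsub>?R\<^esub> ?d) \<otimes>\<^bsub>?R\<^esub> ?P"
  have Y [simp]: "Y \<in> carrier ?R" by (simp add: Y_def)
  have "(rP (1 + 1), scal q * rP 1 * (rT 1 - scal (q - inverse q)) * rP 1) \<in> rook_rels k q"
    by (rule rook_relsI(8)) (use k in auto)
  from rel[OF this] have P2Y: "?P2 = ?a \<otimes>\<^bsub>?R\<^esub> Y"
    by (simp add: M.c_simps free_alg_closed Y_def M.R.m_assoc numeral_2_eq_2)
  have "?b \<otimes>\<^bsub>?R\<^esub> ?a = \<one>\<^bsub>?R\<^esub>"
    using q by (simp add: scal_simps M.c_one flip: M.c_mult)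
  then have YP2: "Y = ?b \<otimes>\<^bsub>?R\<^esub> ?P2"
    unfolding P2Y by (simp flip: M.R.m_assoc)
  have YT: "Y \<otimes>\<^bsub>?R\<^esub> ?T = ?a \<otimes>\<^bsub>?R\<^esub> Y"
    unfolding YP2 M.R.m_assoc[OF carr(4) carr(3) carr(2)] PT2
    by (rule M.R.m_lcomm[OF cent]) simp_all
  have TY: "?T \<otimes>\<^bsub>?R\<^esub> Y = ?a \<otimes>\<^bsub>?R\<^esub> Y"
  proof -
    have "?T \<otimes>\<^bsub>?R\<^esub> Y = ?b \<otimes>\<^bsub>?R\<^esub> (?T \<otimes>\<^bsub>?R\<^esub> ?P2)"
      unfolding YP2 by (rule M.R.m_lcomm[OF cent]) simp_all
    also have "\<dots> = ?a \<otimes>\<^bsub>?R\<^esub> Y"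
      unfolding YP2 TP2 by (rule M.R.m_lcomm[OF cent]) simp_all
    finally show ?thesis .
  qed
  show "\<tau> (sign_elt q) = \<zero>\<^bsub>rook_alg k q\<^esub>"
  proof -
    have "\<tau> (sign_elt q) = Y \<otimes>\<^bsub>?R\<^esub> (?T \<ominus>\<^bsub>?R\<^esub> ?a)"
      by (simp add: \<tau>_def sign_elt_def to_rook_simps Y_def M.c_simps free_alg_closed M.R.m_assoc)
    also have "\<dots> = Y \<otimes>\<^bsub>?R\<^esub> ?T \<ominus>\<^bsub>?R\<^esub> Y \<otimes>\<^bsub>?R\<^esub> ?a"
      by (simp add: M.R.minus_eq M.R.r_distr M.R.r_minus)
    also have "\<dots> = \<zero>\<^bsub>?R\<^esub>"
      unfolding YT cent[OF Y] by (simp add: M.R.minus_eq M.R.r_neg)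
    finally show ?thesis .
  qed
  define X where "X = \<one>\<^bsub>?R\<^esub> \<ominus>\<^bsub>?R\<^esub> ?P"
  have X [simp]: "X \<in> carrier ?R" by (simp add: X_def)
  have cX: "?c (1 - rP 1) = X" by (simp add: X_def M.c_simps free_alg_closed)
  have XX: "X \<otimes>\<^bsub>?R\<^esub> X = X"
    unfolding X_def by (rule M.R.complement_idem[OF carr(1) PP])
  have PX: "?P = \<one>\<^bsub>?R\<^esub> \<ominus>\<^bsub>?R\<^esub> X"
    unfolding X_def by (rule M.R.complement_complement[OF carr(1), symmetric])
  have XTXT: "X \<otimes>\<^bsub>?R\<^esub> ?T \<otimes>\<^bsub>?R\<^esub> X \<otimes>\<^bsub>?R\<^esub> ?T = ?T \<otimes>\<^bsub>?R\<^esub> X \<otimes>\<^bsub>?R\<^esub> ?T \<otimes>\<^bsub>?R\<^esub> X"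
  proof -
    have "Y \<otimes>\<^bsub>?R\<^esub> ?T \<ominus>\<^bsub>?R\<^esub> ?T \<otimes>\<^bsub>?R\<^esub> Y
      = X \<otimes>\<^bsub>?R\<^esub> ?T \<otimes>\<^bsub>?R\<^esub> X \<otimes>\<^bsub>?R\<^esub> ?T \<ominus>\<^bsub>?R\<^esub> ?T \<otimes>\<^bsub>?R\<^esub> X \<otimes>\<^bsub>?R\<^esub> ?T \<otimes>\<^bsub>?R\<^esub> X"
      by (rule M.R.commutator[OF X carr(2) carr(4) cent XX TT]) (simp_all only: Y_def PX[symmetric])
    then show ?thesis
      unfolding YT TY by (simp add: M.R.minus_eq[of "?a \<otimes>\<^bsub>?R\<^esub> Y"] M.R.r_neg)
        (simp add: M.R.minus_eq_zero_iff eq_commute[of "\<zero>\<^bsub>?R\<^esub>"])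
  qed
  fix l r assume lr: "(l, r) \<in> hecke_rels k 0 1 q"
  consider (1) i where "1 \<le> i" "i \<le> k - 1" "l = hT i * hT i" "r = scal (q - inverse q) * hT i + 1"
    | (2) i where "1 \<le> i" "i + 1 \<le> k - 1"
        "l = hT i * hT (i+1) * hT i" "r = hT (i+1) * hT i * hT (i+1)"
    | (3) i j where "i \<in> {1..k - 1}" "j \<in> {1..k - 1}" "i + 1 < j \<or> j + 1 < i"
        "l = hT i * hT j" "r = hT j * hT i"
    | (4) j where "2 \<le> j" "j \<le> k - 1" "l = hX * hT j" "r = hT j * hX"
    | (5) "l = hX * hT 1 * hX * hT 1" "r = hT 1 * hX * hT 1 * hX"
    | (6) "l = (hX - scal 0) * (hX - scal 1)" "r = 0"
    using lr unfolding hecke_rels_def by (auto split: if_splits)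
  then show "\<tau> l = \<tau> r"
  proof cases
    case 1
    then have "(rT i * rT i, scal (q - inverse q) * rT i + 1) \<in> rook_rels k q"
      by (intro rook_relsI(1))
    from rel[OF this] show ?thesis using 1 by (simp add: \<tau>_def to_rook_simps)
  next
    case 2
    then have "(rT i * rT (i+1) * rT i, rT (i+1) * rT i * rT (i+1)) \<in> rook_rels k q"
      by (intro rook_relsI(2))
    from rel[OF this] show ?thesis using 2 by (simp add: \<tau>_def to_rook_simps)
  next
    case 3
    then have "(rT i * rT j, rT j * rT i) \<in> rook_rels k q"
      by (intro rook_relsI(3))
    from rel[OF this] show ?thesis using 3 by (simp add: \<tau>_def to_rook_simps)
  next
    case 4
    then have "(rP 1 * rT j, rT j * rP 1) \<in> rook_rels k q"
      by (intro rook_relsI(5)) auto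
    from rel[OF this] show ?thesis using 4
      by (simp add: \<tau>_def to_rook_simps left_diff_distrib right_diff_distrib M.c_simps free_alg_closed)
  next
    case 5
    then show ?thesis
      using XTXT by (simp add: \<tau>_def to_rook_simps M.c_mult cX[simplified] free_alg_closed)
  next
    case 6
    have "to_rook l = rP 1 * rP 1 - rP 1"
      unfolding 6(1) by (simp add: to_rook_simps scal_simps algebra_simps)
    then have "\<tau> l = ?P \<otimes>\<^bsub>?R\<^esub> ?P \<ominus>\<^bsub>?R\<^esub> ?P"
      unfolding \<tau>_def by (simp add: M.c_diff M.c_mult free_alg_closed)
    also have "\<dots> = \<zero>\<^bsub>?R\<^esub>"
      unfolding PP by (simp add: M.R.minus_eq M.R.r_neg)
    finally show ?thesis
      using 6 by (simp add: \<tau>_def to_rook_simps M.c_zero)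
  qed
qed

context hecke_map
begin

lemma c_hecke_P_closed: "i \<le> k \<Longrightarrow> c (hecke_P q i) \<in> carrier R"
  by (simp add: hecke_P_closed)

lemma c_hecke_P_1: "c (hecke_P q 1) = \<one> \<ominus> X"
  by (simp add: c_simps free_alg_closed)

lemma c_hecke_P_Suc:
  assumes "1 \<le> i" "i < k"
  shows "c (hecke_P q (Suc i)) =
    a \<otimes> c (hecke_P q i) \<otimes> (T i \<ominus> (a \<ominus> b)) \<otimes> c (hecke_P q i)"
proof -
  obtain m where m: "i = Suc m" using assms by (cases i) auto
  have "hecke_P q i \<in> carrier (free_alg (hecke_gens k))" "hT i \<in> carrier (free_alg (hecke_gens k))"
    using assms by (simp_all add: hecke_P_closed)
  then show ?thesis
    unfolding m by (simp add: c_mult c_diff[of "hT (Suc m)"] c_scal_diff free_alg_closed)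
qed

lemma rook_tower:
  assumes Z: "Z = \<zero>"
  shows "rook_tower R a b (\<lambda>i. T i) (\<lambda>i. c (hecke_P q i)) k"
proof
  show "c (hecke_P q 1) \<otimes> c (hecke_P q 1) = c (hecke_P q 1)"
    unfolding c_hecke_P_1 by (rule R.complement_idem[OF closed(1) XX])
  show "c (hecke_P q 1) \<otimes> T j = T j \<otimes> c (hecke_P q 1)" if "2 \<le> j" "j < k" for j
    unfolding c_hecke_P_1 using that X_comm[OF that]
    by (simp add: R.minus_eq R.l_distr R.r_distr R.l_minus R.r_minus)
  have P2: "c (hecke_P q 2) = a \<otimes> Y"
    using c_hecke_P_Suc[of 1] k
    by (simp add: c_hecke_P_1[simplified] Y_def numeral_2_eq_2 R.m_assoc)
  have YT: "Y \<otimes> T 1 = a \<otimes> Y" using Z_zero_iff Z by simp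
  have "T 1 \<otimes> (a \<otimes> Y) = a \<otimes> (T 1 \<otimes> Y)"
    by (rule R.m_lcomm[OF c_scal_central]) simp_all
  then show "T 1 \<otimes> c (hecke_P q 2) = a \<otimes> c (hecke_P q 2)"
    unfolding P2 Y_comm[symmetric] YT .
  have "(a \<otimes> Y) \<otimes> T 1 = a \<otimes> (Y \<otimes> T 1)" by (rule R.m_assoc) simp_all
  then show "c (hecke_P q 2) \<otimes> T 1 = a \<otimes> c (hecke_P q 2)"
    unfolding P2 YT .
  show "T i \<otimes> T j = T j \<otimes> T i"
    if "1 \<le> i" "i < k" "1 \<le> j" "j < k" "Suc i < j" for i j
    using that by (rule far)
qed (simp_all add: c_scal_central ab TT braid c_hecke_P_closed c_hecke_P_Suc)

lemma to_hecke_map: "free_alg_map R (rook_gens k) (\<lambda>p. c (to_hecke q p))"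
proof -
  have "(\<lambda>p. c (to_hecke q p)) \<in> Ring.ring_hom (free_alg (rook_gens k)) R"
    by (rule Ring.ring_hom_memI)
      (simp_all add: to_hecke_closed to_hecke_simps c_mult c_add c_one)
  then show ?thesis
    by (simp add: free_alg_map_def free_alg_map_axioms_def ring_free_alg R.ring_axioms)
qed

text \<open>
  The converse: where the sign element vanishes, the elements \<open>hecke_P q i\<close> satisfy the relations
  of the rook monoid algebra.
\<close>
lemma rook_relations:
  assumes Z: "Z = \<zero>" and lr: "(l, r) \<in> rook_rels k q"
  shows "c (to_hecke q l) = c (to_hecke q r)"
proof -
  interpret tower: rook_tower R a b "\<lambda>i. T i" "\<lambda>i. c (hecke_P q i)" k by (rule rook_tower[OF Z])
  let ?P = "\<lambda>i. c (hecke_P q i)"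
  have hP: "hecke_P q i \<in> carrier (free_alg (hecke_gens k))" if "i \<le> k" for i
    using that by (rule hecke_P_closed)
  note simps = to_hecke_simps c_mult c_add c_one c_diff c_scal_diff free_alg_closed
  have lt: "i < k" if "1 \<le> i" "i \<le> k - 1" for i using that by simp
  consider (1) i where "1 \<le> i" "i \<le> k - 1" "l = rT i * rT i" "r = scal (q - inverse q) * rT i + 1"
    | (2) i where "1 \<le> i" "i + 1 \<le> k - 1"
        "l = rT i * rT (i+1) * rT i" "r = rT (i+1) * rT i * rT (i+1)"
    | (3) i j where "1 \<le> i" "i \<le> k - 1" "1 \<le> j" "j \<le> k - 1" "i + 1 < j \<or> j + 1 < i"
        "l = rT i * rT j" "r = rT j * rT i"
    | (4) i where "1 \<le> i" "i \<le> k" "l = rP i * rP i" "r = rP i"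
    | (5) i j where "1 \<le> i" "i \<le> k" "1 \<le> j" "j \<le> k" "l = rP i * rP j" "r = rP j * rP i"
    | (6) i j where "1 \<le> i" "i < j" "j \<le> k - 1" "l = rP i * rT j" "r = rT j * rP i"
    | (7) i j where "1 \<le> j" "j < i" "i \<le> k" "l = rP i * rT j" "r = rT j * rP i"
    | (8) i j where "1 \<le> j" "j < i" "i \<le> k" "l = rT j * rP i" "r = scal q * rP i"
    | (9) i where "1 \<le> i" "i \<le> k - 1" "l = rP (i+1)"
        "r = scal q * rP i * (rT i - scal (q - inverse q)) * rP i"
    | (10) i where "1 \<le> i" "i \<le> k - 1" "l = rP (i+1)"
        "r = scal q * (rP i * rT i * rP i - scal (q - inverse q) * rP i)"
    using lr unfolding rook_rels_def by auto
  then show ?thesis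
  proof cases
    case 1
    then show ?thesis using TT[of i] lt by (simp add: simps)
  next
    case 2
    then show ?thesis using braid[of i] by (simp add: simps)
  next
    case 3
    then show ?thesis using far[of i j] far[of j i] lt by (auto simp: simps)
  next
    case 4
    then show ?thesis using tower.P_mult[of i i] by (simp add: simps hP)
  next
    case 5
    then show ?thesis using tower.P_mult[of i j] tower.P_mult[of j i]
      by (simp add: simps hP max.commute)
  next
    case 6
    then show ?thesis using tower.P_comm[of i j] by (simp add: simps hP)
  next
    case 7
    then show ?thesis using tower.P_props[of i] by (simp add: simps hP)
  next
    case 8
    then show ?thesis using tower.P_props[of i] by (simp add: simps hP)
  next
    case 9
    then show ?thesis using c_hecke_P_Suc[of i] by (simp add: simps hP)
  next
    case 10
    have carr [simp]: "?P i \<in> carrier R" "T i \<in> carrier R" using 10 lt by (simp_all add: c_hecke_P_closed)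
    have PP: "?P i \<otimes> ?P i = ?P i" using 10 tower.P_mult[of i i] by simp
    have "?P i \<otimes> (T i \<ominus> (a \<ominus> b)) \<otimes> ?P i = ?P i \<otimes> T i \<otimes> ?P i \<ominus> (a \<ominus> b) \<otimes> ?P i"
    proof -
      have "?P i \<otimes> (T i \<ominus> (a \<ominus> b)) = ?P i \<otimes> T i \<ominus> (a \<ominus> b) \<otimes> ?P i"
        using d_central[of "?P i"] by (simp add: R.minus_eq[of "T i"] R.minus_eq[of "?P i \<otimes> T i"] R.r_distr R.r_minus)
      then show ?thesis
        by (simp add: R.minus_eq[of "?P i \<otimes> T i"] R.minus_eq[of "?P i \<otimes> (T i \<otimes> ?P i)"] R.l_distr R.l_minus R.m_assoc PP)
    qed
    then have "a \<otimes> ?P i \<otimes> (T i \<ominus> (a \<ominus> b)) \<otimes> ?P i = a \<otimes> (?P i \<otimes> T i \<otimes> ?P i \<ominus> (a \<ominus> b) \<otimes> ?P i)"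
      by (simp add: R.m_assoc)
    then show ?thesis using 10 c_hecke_P_Suc[of i] by (simp add: simps hP)
  qed
qed

end

lemma to_rook_to_hecke:
  assumes "1 \<le> k" "y \<in> carrier (free_alg (rook_gens k))"
  shows "rook_class k q (to_rook (to_hecke q y)) = rook_class k q y"
proof -
  let ?c = "rook_class k q"
  interpret P: presentation "rook_gens k" "rook_rels k q" by (rule rook_presentation)
  interpret M: free_alg_map "rook_alg k q" "rook_gens k" ?c
    using P.free_alg_map by (simp add: rook_alg_def rook_class_def)
  have rel: "?c l = ?c r" if "(l, r) \<in> rook_rels k q" for l r
    using P.class_rel that rook_rels_carrier[OF that] by (simp add: rook_class_def)
  have closed: "to_rook (to_hecke q p) \<in> carrier (free_alg (rook_gens k))"
    if "p \<in> carrier (free_alg (rook_gens k))" for p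
    using that assms(1) by (intro to_rook_closed to_hecke_closed)
  have P: "?c (to_rook (hecke_P q i)) = ?c (rP i)" if "1 \<le> i" "i \<le> k" for i
    using that
  proof (induction i rule: nat_induct_at_least)
    case base
    then show ?case by (simp add: to_rook_simps)
  next
    case (Suc i)
    obtain m where m: "i = Suc m" using Suc.hyps by (cases i) auto
    have cl: "to_rook (hecke_P q i) \<in> carrier (free_alg (rook_gens k))"
      using Suc assms(1) by (intro to_rook_closed hecke_P_closed) auto
    have "?c (to_rook (hecke_P q (Suc i)))
        = ?c (scal q * to_rook (hecke_P q i) * (rT i - scal (q - inverse q)) * to_rook (hecke_P q i))"
      by (simp add: m to_rook_simps)
    also have "\<dots> = ?c (scal q * rP i * (rT i - scal (q - inverse q)) * rP i)"
      using Suc cl by (simp add: M.c_mult free_alg_closed)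
    also have "\<dots> = ?c (rP (i + 1))"
      by (rule rel[symmetric], rule rook_relsI(8)) (use Suc in auto)
    finally show ?case by simp
  qed
  show ?thesis
    using assms(2)
  proof (induction rule: free_alg_induct)
    case (gen g)
    then show ?case using P by (auto simp: rook_gens_def to_hecke_simps to_rook_simps)
  qed (simp_all add: to_hecke_simps to_rook_simps M.c_add M.c_mult closed)
qed

section \<open>The rook monoid algebra as a quotient of the Hecke algebra\<close>

lemma hecke_incl_sign_line:
  assumes "2 \<le> k"
  shows "hecke_incl k 0 1 q ` sign_line q = range (\<lambda>e. hecke_class k 0 1 q (scal e * sign_elt q))"
  unfolding sign_line_def image_image
  by (intro image_cong refl hecke_incl_class assms free_alg_closed sign_elt_closed) simp

lemma alg_hom_comp:
  assumes "f \<in> alg_hom A B" "g \<in> alg_hom B C"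
  shows "(\<lambda>x. g (f x)) \<in> alg_hom A C"
  using assms by (auto simp: alg_hom_def Ring.ring_hom_def Pi_iff)

theorem mainTheorem2:
  fixes q :: complex and k :: nat
  assumes "q \<noteq> 0"
    and "k \<ge> 2"
    and "semisimple_alg (hecke_alg 2 0 1 q)"
  shows "\<exists>\<phi> \<in> alg_iso (alg_quot (hecke_alg k 0 1 q) (hecke_ideal k 0 1 q)) (rook_alg k q).
      \<phi> (hecke_ideal k 0 1 q +>\<^bsub>hecke_alg k 0 1 q\<^esub> hecke_class k 0 1 q hX)
        = rook_class k q (1 - rP 1) \<and>
      (\<forall>i \<in> {1..k - 1}.
        \<phi> (hecke_ideal k 0 1 q +>\<^bsub>hecke_alg k 0 1 q\<^esub> hecke_class k 0 1 q (hT i))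
          = rook_class k q (rT i))"
proof -
  note q = assms(1) and k = assms(2)
  let ?F = "free_alg (hecke_gens k)" and ?E = "free_alg (rook_gens k)"
  let ?H = "hecke_alg k 0 1 q" and ?h = "hecke_class k 0 1 q" and ?I = "hecke_ideal k 0 1 q"
  let ?Q = "alg_quot ?H ?I" and ?R = "rook_alg k q" and ?c = "rook_class k q"
  interpret H: hecke_map ?H k ?h q by (rule hecke_map_class[OF q k])
  interpret P: presentation "hecke_gens k" "hecke_rels k 0 1 q" by (rule hecke_presentation)
  interpret PR: presentation "rook_gens k" "rook_rels k q" by (rule rook_presentation)
  have h_hom: "?h \<in> alg_hom ?F ?H"
    and scalars: "has_scalars ?H (\<lambda>e. ?h (scal e))"
    using P.class_hom P.has_scalars_presented by (simp_all add: hecke_alg_def hecke_class_def)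
  have c_hom: "?c \<in> alg_hom ?E ?R" and c_surj: "?c ` carrier ?E = carrier ?R"
    using PR.class_hom PR.class_surj by (simp_all add: rook_alg_def rook_class_def)

  \<comment> \<open>\<open>I\<close> is generated by the multiples of the sign element.\<close>
  define S where "S = range (\<lambda>e. ?h (scal e * sign_elt q))"
  have S_closed: "S \<subseteq> carrier ?H"
    using k by (auto simp: S_def free_alg_closed sign_elt_closed)
  have I_eq: "?I = Idl\<^bsub>?H\<^esub> S"
    by (simp add: hecke_ideal_def hecke_sign_ideal_eq[OF q assms(3)] hecke_incl_sign_line[OF k] S_def)
  have I: "ideal ?I ?H" unfolding I_eq by (rule H.R.genideal_ideal[OF S_closed])
  have "?h (scal 1 * sign_elt q) \<in> S" unfolding S_def by blast
  then have Z_in: "?h (sign_elt q) \<in> ?I"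
    unfolding I_eq using H.R.genideal_self[OF S_closed] by (auto simp: scal_simps)

  define \<pi> where "\<pi> p = ?I +>\<^bsub>?H\<^esub> ?h p" for p
  have \<pi>_hom: "\<pi> \<in> alg_hom ?F ?Q"
    unfolding \<pi>_def [abs_def] by (rule alg_hom_comp[OF h_hom alg_quot_hom(1)[OF scalars I]])
  have \<pi>_surj: "\<pi> ` carrier ?F = carrier ?Q"
    unfolding alg_quot_hom(2)[OF scalars I, symmetric] H.surj[symmetric] by (simp add: \<pi>_def image_image)
  interpret Q: hecke_map ?Q k \<pi> q
  proof -
    have "free_alg_map ?Q (hecke_gens k) \<pi>"
      using \<pi>_hom alg_quot_hom(3)[OF scalars I]
      by (simp add: free_alg_map_def free_alg_map_axioms_def ring_free_alg alg_hom_def)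
    then show "hecke_map ?Q k \<pi> q"
      using q k \<pi>_surj H.rel by (simp add: hecke_map_def hecke_map_axioms_def \<pi>_def)
  qed
  have \<pi>_zero: "\<pi> (sign_elt q) = \<zero>\<^bsub>?Q\<^esub>"
  proof -
    interpret I: ideal ?I ?H by (rule I)
    show ?thesis
      unfolding \<pi>_def by (simp add: FactRing_def H.R.a_coset_join2 I.a_subgroup Z_in)
  qed

  define \<tau> where "\<tau> p = ?c (to_rook p)" for p
  interpret \<tau>: free_alg_map ?R "hecke_gens k" \<tau>
    using rook_hecke_relations(1)[OF q k] by (simp add: \<tau>_def [abs_def])
  \<comment> \<open>The kernel of \<open>\<tau>\<close> contains the Hecke relations and the sign element; so its image in \<open>H\<^sub>k\<close> is
    an ideal that contains \<open>I\<close>, and \<open>\<tau>\<close> descends to \<open>H\<^sub>k / I\<close>.\<close>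
  define N where "N = {p \<in> carrier ?F. \<tau> p = \<zero>\<^bsub>?R\<^esub>}"
  have N: "ideal N ?F" unfolding N_def by (rule \<tau>.kernel_ideal)
  have rel_N: "rel_ideal (hecke_gens k) (hecke_rels k 0 1 q) \<subseteq> N"
    unfolding N_def
    using rook_hecke_relations(2)[OF q k] hecke_rels_carrier
    by (intro \<tau>.factor) (auto simp: \<tau>_def)
  have I_N: "?I \<subseteq> ?h ` N"
    unfolding I_eq
  proof (rule H.R.genideal_minimal)
    have "ideal (?h ` N) (free_alg (hecke_gens k) Quot rel_ideal (hecke_gens k) (hecke_rels k 0 1 q))"
      unfolding hecke_class_def presented_class_def [abs_def]
      by (rule ring.ring_ideal_imp_quot_ideal[OF ring_free_alg P.rel_ideal N])
    then show "ideal (?h ` N) ?H"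
      unfolding hecke_alg_def presented_alg_def
      by (rule ideal_alg_quotI[OF has_scalars_free_alg P.rel_ideal])
    have "sign_elt q \<in> N"
      using rook_hecke_relations(3)[OF q k] k by (simp add: N_def \<tau>_def sign_elt_closed)
    then have "scal e * sign_elt q \<in> N" for e
      using ideal.I_l_closed[OF N, of "sign_elt q" "scal e"] by (simp add: free_alg_closed)
    then show "S \<subseteq> ?h ` N" by (auto simp: S_def)
  qed

  \<comment> \<open>In the other direction, the vanishing of the sign element in \<open>H\<^sub>k / I\<close> gives the rook relations.\<close>
  interpret G: free_alg_map ?Q "rook_gens k" "\<lambda>p. \<pi> (to_hecke q p)" by (rule Q.to_hecke_map)
  have "\<exists>\<phi> \<in> alg_iso ?Q ?R. \<forall>x \<in> carrier ?F. \<phi> (\<pi> x) = ?c (to_rook x)"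
  proof (rule alg_iso_of_mutually_inverse[OF ring_free_alg \<pi>_hom \<pi>_surj c_hom c_surj])
    show "to_rook \<in> alg_hom ?F ?E"
      using k to_rook_closed[of k]
      by (auto simp: alg_hom_def Ring.ring_hom_def to_rook_simps)
    show "to_hecke q y \<in> carrier ?F" if "y \<in> carrier ?E" for y
      using that by (rule to_hecke_closed)
    show "e \<odot>\<^bsub>?F\<^esub> x \<in> carrier ?F" if "x \<in> carrier ?F" for e x
      using that by (simp add: free_alg_closed)
    show "\<pi> (to_hecke q (to_rook x)) = \<pi> x" if "x \<in> carrier ?F" for x
      using to_hecke_to_rook[OF that] by simp
    show "?c (to_rook (to_hecke q y)) = ?c y" if "y \<in> carrier ?E" for y
      using to_rook_to_hecke[OF _ that] k by simp
  next
    fix x y assume xy: "x \<in> carrier ?E" "y \<in> carrier ?E" and eq: "?c x = ?c y"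
    then have "x - y \<in> rel_ideal (rook_gens k) (rook_rels k q)"
      using PR.class_eq_iff by (simp add: rook_class_def)
    moreover have "rel_ideal (rook_gens k) (rook_rels k q)
        \<subseteq> {p \<in> carrier ?E. \<pi> (to_hecke q p) = \<zero>\<^bsub>?Q\<^esub>}"
      using Q.rook_relations[OF \<pi>_zero] rook_rels_carrier by (intro G.factor) auto
    ultimately have "\<pi> (to_hecke q x) \<ominus>\<^bsub>?Q\<^esub> \<pi> (to_hecke q y) = \<zero>\<^bsub>?Q\<^esub>"
      using G.c_diff[OF xy] by auto
    then show "\<pi> (to_hecke q x) = \<pi> (to_hecke q y)"
      using xy Q.R.minus_eq_zero_iff G.c_closed by blast
  next
    fix x y assume xy: "x \<in> carrier ?F" "y \<in> carrier ?F" and eq: "\<pi> x = \<pi> y"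
    have d: "x - y \<in> carrier ?F" using xy by (rule free_alg_closed)
    have "?h x \<ominus>\<^bsub>?H\<^esub> ?h y \<in> ?I"
      using eq coset_eq_iff[OF I, of "?h x" "?h y"] xy by (simp add: \<pi>_def)
    then have "?h (x - y) \<in> ?h ` N" using I_N H.c_diff[OF xy] by auto
    then obtain n where n: "n \<in> N" "?h (x - y) = ?h n" by blast
    then have "n \<in> carrier ?F" by (simp add: N_def)
    then have "x - y - n \<in> N"
      using n d P.class_eq_iff[of "x - y" n] rel_N by (auto simp: hecke_class_def)
    then have "\<tau> (x - y - n) = \<zero>\<^bsub>?R\<^esub>" "\<tau> n = \<zero>\<^bsub>?R\<^esub>" using n by (simp_all add: N_def)
    then have "\<tau> (x - y) = \<zero>\<^bsub>?R\<^esub>"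
      using \<tau>.c_add[of "x - y - n" n] d \<open>n \<in> carrier ?F\<close> by (simp add: free_alg_closed)
    then have "\<tau> x \<ominus>\<^bsub>?R\<^esub> \<tau> y = \<zero>\<^bsub>?R\<^esub>" using \<tau>.c_diff[OF xy] by simp
    then show "?c (to_rook x) = ?c (to_rook y)"
      using xy \<tau>.c_closed by (simp add: \<tau>.R.minus_eq_zero_iff flip: \<tau>_def)
  qed
  then obtain \<phi> where \<phi>: "\<phi> \<in> alg_iso ?Q ?R" "\<And>x. x \<in> carrier ?F \<Longrightarrow> \<phi> (\<pi> x) = ?c (to_rook x)"
    by blast
  show ?thesis
  proof (intro bexI[OF _ \<phi>(1)] conjI ballI)
    show "\<phi> (?I +>\<^bsub>?H\<^esub> ?h hX) = ?c (1 - rP 1)"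
      using \<phi>(2)[of hX] by (simp add: \<pi>_def to_rook_simps)
    show "\<phi> (?I +>\<^bsub>?H\<^esub> ?h (hT i)) = ?c (rT i)" if "i \<in> {1..k - 1}" for i
    proof -
      have "1 \<le> i" "i < k" using that k by auto
      then show ?thesis using \<phi>(2)[of "hT i"] by (simp add: \<pi>_def to_rook_simps)
    qed
  qed
qed

end
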